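(* Let $U$ and $U_n$, $n\in\mathbb{N}$, be simply connected domains, let $F_n:U\to U_n$, $n\in\mathbb{N}$, be a sequence of holomorphic maps, each with a full radial extension to $\partial U$, and suppose that there exists $z_0\in U$ such that \[ \sum_{n=1}^{\infty}\operatorname{dist}(F_n(z_0),\partial U_n)^{1/2}<\infty . \] Then almost all points in $\partial U$ (with respect to harmonic measure) belong to the Denjoy--Wolff set of $(F_n)$.
   Context: Simply connected domains are always assumed to be proper subsets of $\mathbb{C}$. $\operatorname{dist}$ is Euclidean distance. $\mathbb{D}$ is the unit disc. Harmonic measure. For a simply connected domain $U$, $z\in U$ and a conformal map $\varphi:\mathbb{D}\to U$ (onto) with $\varphi(0)=z$, the harmonic measure of a Borel set $A\subset\partial U$ is $\omega(z,A,U)=\lambda((\varphi^* )^{-1}(A))$, where $\lambda$ is normalised Lebesgue measure on $\partial\mathbb{D}$ and $\varphi^*(\xi)=\lim_{r\to1^-}\varphi(r\xi)$ at the points $\xi\in\partial\mathbb{D}$ where this radial limit exists and is finite. Sets of zero/full harmonic measure do not depend on $z$. Radial extensions. A point $p\in\partial U$ is accessible from $U$ if there is an arc $\gamma:[0,1)\to U$ with $\gamma(t)\to p$ as $t\to1$; $\operatorname{AP}(U)$ is the set of such points. Let $f:U\to V$ be a holomorphic map between simply connected domains, $p\in\operatorname{AP}(U)$, and $\phi:\mathbb{D}\to U$ a Riemann map. A curve in $U$ approaches $p$ radially if it converges to $p$ and is the image under $\phi$ of a curve in $\mathbb{D}$ that approaches a point of $\partial\mathbb{D}$ nontangentially. $f$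 has a radial extension to $p$ with value $f^*(p)$ if for every arc $\gamma(t)$, $t\in[0,1)$, in $U$ such that $\gamma(t)\to p$ radially as $t\to1$, we have $f(\gamma(t))\to f^*(p)$ as $t\to1$. $f$ has a full radial extension (to $\partial U$) if the domain of $f^*$ includes a subset of $\operatorname{AP}(U)$ of full harmonic measure with respect to $U$. The extension is again denoted by $f$. Denjoy--Wolff set. If $\operatorname{dist}(F_n(z),\partial U_n)\to0$ as $n\to\infty$ for all $z\in U$, the Denjoy--Wolff set of $(F_n)$ is the set of $\zeta\in\partial U$ (at which the extensions $F_n(\zeta)$ are defined) such that, for all $z\in U$, $|F_n(\zeta)-F_n(z)|\to0$ as $n\to\infty$. *)

theory Defs
  imports "HOL-Complex_Analysis.Complex_Analysis"
begin

definition simply_connected_domain :: "complex set \<Rightarrow> bool" where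
  "simply_connected_domain U \<longleftrightarrow> open U \<and> U \<noteq> {} \<and> simply_connected U \<and> U \<noteq> UNIV"

definition riemann_map :: "complex set \<Rightarrow> (complex \<Rightarrow> complex) \<Rightarrow> bool" where
  "riemann_map U \<phi> \<longleftrightarrow> \<phi> holomorphic_on ball 0 1 \<and> bij_betw \<phi> (ball 0 1) U"


text \<open>Normalised arc length on the unit circle, as a Borel probability measure on the plane.\<close>

definition circle_measure :: "complex measure" where
  "circle_measure = distr (uniform_measure lborel {0..<2 * pi}) borel cis"

text \<open>The points of the unit circle at which \<open>\<phi>\<close> has a finite radial limit, and that limit.\<close>

definition radial_limit_dom :: "(complex \<Rightarrow> complex) \<Rightarrow> complex set" where
  "radial_limit_dom \<phi> =
     {\<xi> \<in> sphere 0 1. \<exists>l. ((\<lambda>r. \<phi> (of_real r * \<xi>)) \<longlongrightarrow> l) (at_left 1)}"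

definition radial_limit :: "(complex \<Rightarrow> complex) \<Rightarrow> complex \<Rightarrow> complex" where
  "radial_limit \<phi> \<xi> = Lim (at_left 1) (\<lambda>r. \<phi> (of_real r * \<xi>))"

text \<open>The harmonic measure of \<open>U\<close> seen from \<open>z\<close>, a measure on the Borel subsets of the boundary.
  Two Riemann maps sending \<open>0\<close> to \<open>z\<close> differ by a rotation of the disc, under which
  \<^const>\<open>circle_measure\<close> is invariant, so the choice of \<open>\<phi>\<close> is immaterial. The map being pushed
  forward is measurable, see \<open>emeasure_harmonic_measure\<close> below.\<close>

definition riemann_map_at :: "complex set \<Rightarrow> complex \<Rightarrow> complex \<Rightarrow> complex" where
  "riemann_map_at U z = (SOME \<phi>. riemann_map U \<phi> \<and> \<phi> 0 = z)"

definition harmonic_measure :: "complex set \<Rightarrow> complex \<Rightarrow> complex measure" where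
  "harmonic_measure U z =
     (let \<phi> = riemann_map_at U z in
      distr (restrict_space circle_measure (radial_limit_dom \<phi>))
        (restrict_space borel (frontier U)) (radial_limit \<phi>))"

text \<open>\<open>A\<close> need not be Borel: by \<open>AE\<close>, the boundary points outside \<open>A\<close> are to be covered by a
  Borel set of harmonic measure zero.\<close>

definition full_harmonic_measure :: "complex set \<Rightarrow> complex set \<Rightarrow> bool" where
  "full_harmonic_measure U A \<longleftrightarrow> (\<forall>z\<in>U. AE \<zeta> in harmonic_measure U z. \<zeta> \<in> A)"


definition arc_in :: "complex set \<Rightarrow> (real \<Rightarrow> complex) \<Rightarrow> bool" where
  "arc_in U \<gamma> \<longleftrightarrow> continuous_on {0..<1} \<gamma> \<and> inj_on \<gamma> {0..<1} \<and> \<gamma> ` {0..<1} \<subseteq> U"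

definition accessible_points :: "complex set \<Rightarrow> complex set" where
  "accessible_points U = {p \<in> frontier U. \<exists>\<gamma>. arc_in U \<gamma> \<and> (\<gamma> \<longlongrightarrow> p) (at_left 1)}"

text \<open>\<open>\<sigma>\<close> is a curve in the disc that tends to the boundary point \<open>\<xi>\<close> inside some Stolz angle.\<close>

definition approaches_nontangentially :: "(real \<Rightarrow> complex) \<Rightarrow> complex \<Rightarrow> bool" where
  "approaches_nontangentially \<sigma> \<xi> \<longleftrightarrow>
     continuous_on {0..<1} \<sigma> \<and> \<sigma> ` {0..<1} \<subseteq> ball 0 1 \<and> \<xi> \<in> sphere 0 1 \<and>
     (\<sigma> \<longlongrightarrow> \<xi>) (at_left 1) \<and>
     (\<exists>M. \<forall>\<^sub>F t in at_left 1. cmod (\<sigma> t - \<xi>) \<le> M * (1 - cmod (\<sigma> t)))"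

text \<open>Two Riemann maps onto \<open>U\<close> differ by an automorphism of the disc, which preserves
  nontangential approach, so it does not matter which \<open>\<phi>\<close> is used here.\<close>

definition approaches_radially ::
    "complex set \<Rightarrow> (real \<Rightarrow> complex) \<Rightarrow> complex \<Rightarrow> bool" where
  "approaches_radially U \<gamma> p \<longleftrightarrow>
     (\<gamma> \<longlongrightarrow> p) (at_left 1) \<and>
     (\<exists>\<phi> \<sigma> \<xi>. riemann_map U \<phi> \<and> approaches_nontangentially \<sigma> \<xi> \<and>
        (\<forall>t\<in>{0..<1}. \<gamma> t = \<phi> (\<sigma> t)))"

definition has_radial_extension ::
    "complex set \<Rightarrow> (complex \<Rightarrow> complex) \<Rightarrow> complex \<Rightarrow> complex \<Rightarrow> bool" where
  "has_radial_extension U f p v \<longleftrightarrow>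
     p \<in> accessible_points U \<and>
     (\<forall>\<gamma>. arc_in U \<gamma> \<and> approaches_radially U \<gamma> p \<longrightarrow> ((\<lambda>t. f (\<gamma> t)) \<longlongrightarrow> v) (at_left 1))"

definition radial_extension_dom :: "complex set \<Rightarrow> (complex \<Rightarrow> complex) \<Rightarrow> complex set" where
  "radial_extension_dom U f = {p. \<exists>v. has_radial_extension U f p v}"

text \<open>The value is unique because every accessible point is approached radially by some arc.\<close>

definition radial_extension ::
    "complex set \<Rightarrow> (complex \<Rightarrow> complex) \<Rightarrow> complex \<Rightarrow> complex" where
  "radial_extension U f p = (THE v. has_radial_extension U f p v)"

definition has_full_radial_extension :: "complex set \<Rightarrow> (complex \<Rightarrow> complex) \<Rightarrow> bool" where
  "has_full_radial_extension U f \<longleftrightarrow>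
     (\<exists>A. A \<subseteq> accessible_points U \<and> full_harmonic_measure U A \<and> A \<subseteq> radial_extension_dom U f)"


text \<open>The Denjoy--Wolff set is only meaningful if the distances of \<open>F n z\<close> to the boundary of
  \<open>V n\<close> tend to \<open>0\<close> for all \<open>z\<close> in \<open>U\<close>; otherwise it is the empty set here. Membership of
  a point thus entails that condition.\<close>

definition Denjoy_Wolff_set ::
    "complex set \<Rightarrow> (nat \<Rightarrow> complex set) \<Rightarrow> (nat \<Rightarrow> complex \<Rightarrow> complex) \<Rightarrow> complex set" where
  "Denjoy_Wolff_set U V F =
     {\<zeta> \<in> frontier U.
        (\<forall>z\<in>U. (\<lambda>n. infdist (F n z) (frontier (V n))) \<longlonglongrightarrow> 0) \<and>
        (\<forall>n. \<zeta> \<in> radial_extension_dom U (F n)) \<and>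
        (\<forall>z\<in>U. (\<lambda>n. cmod (radial_extension U (F n) \<zeta> - F n z)) \<longlonglongrightarrow> 0)}"


lemma riemann_map_at:
  assumes "simply_connected_domain U" "z \<in> U"
  shows "riemann_map U (riemann_map_at U z)" "riemann_map_at U z 0 = z"
proof -
  have "open U \<and> simply_connected U" "U \<noteq> {}" "U \<noteq> UNIV"
    using assms by (auto simp: simply_connected_domain_def)
  then obtain f g where g: "g holomorphic_on ball 0 1"
      "\<And>w. w \<in> U \<Longrightarrow> f w \<in> ball 0 1 \<and> g (f w) = w"
      "\<And>w. w \<in> ball 0 1 \<Longrightarrow> g w \<in> U \<and> f (g w) = w"
    using Riemann_mapping_theorem[of U] by blast
  have a: "f z \<in> ball 0 1"
    using g(2)[OF assms(2)] by simp
  obtain h k where h: "h (f z) = 0" "h holomorphic_on ball 0 1" "k holomorphic_on ball 0 1"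
      "\<And>w. w \<in> ball 0 1 \<Longrightarrow> h w \<in> ball 0 1" "\<And>w. w \<in> ball 0 1 \<Longrightarrow> k w \<in> ball 0 1"
      "\<And>w. w \<in> ball 0 1 \<Longrightarrow> h (k w) = w" "\<And>w. w \<in> ball 0 1 \<Longrightarrow> k (h w) = w"
  proof (rule ball_biholomorphism_exists[OF a], goal_cases)
    case (1 h k)
    show thesis
      by (rule that[of h k]) (use 1(2-) in \<open>auto simp: image_subset_iff\<close>)
  qed
  have k0: "k 0 = f z"
    using h(1) h(7)[of "f z"] a by simp
  have "(g \<circ> k) holomorphic_on ball 0 1"
    using h(3,5) g(1) by (intro holomorphic_on_compose_gen) auto
  moreover have "bij_betw (g \<circ> k) (ball 0 1) U"
    by (rule bij_betw_byWitness[where f' = "h \<circ> f"]) (use g h in \<open>auto simp: image_subset_iff\<close>)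
  ultimately have "riemann_map U (g \<circ> k) \<and> (g \<circ> k) 0 = z"
    using k0 g(2)[OF assms(2)] by (simp add: riemann_map_def)
  then have "riemann_map U (riemann_map_at U z) \<and> riemann_map_at U z 0 = z"
    unfolding riemann_map_at_def
    by (rule someI[where P = "\<lambda>\<phi>. riemann_map U \<phi> \<and> \<phi> 0 = z"])
  then show "riemann_map U (riemann_map_at U z)" "riemann_map_at U z 0 = z"
    by auto
qed

lemma tendsto_imp_radial_limit:
  "((\<lambda>r. \<phi> (of_real r * \<xi>)) \<longlongrightarrow> l) (at_left 1) \<Longrightarrow> radial_limit \<phi> \<xi> = l"
  unfolding radial_limit_def by (rule tendsto_Lim) auto

lemma tendsto_radial_limit:
  "\<xi> \<in> radial_limit_dom \<phi> \<Longrightarrow> ((\<lambda>r. \<phi> (of_real r * \<xi>)) \<longlongrightarrow> radial_limit \<phi> \<xi>) (at_left 1)"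
  using tendsto_imp_radial_limit by (fastforce simp: radial_limit_dom_def)

lemma continuous_on_radial:
  assumes "continuous_on (ball 0 1) \<phi>" "0 < r" "r < 1"
  shows "continuous_on (sphere 0 1) (\<lambda>\<xi>. \<phi> (complex_of_real r * \<xi>))"
  by (rule continuous_on_compose2[OF assms(1)])
     (use assms in \<open>auto intro!: continuous_intros simp: norm_mult\<close>)

lemma convergent_at_left_iff:
  fixes h :: "real \<Rightarrow> complex"
  shows "(\<exists>l. (h \<longlongrightarrow> l) (at_left 1)) \<longleftrightarrow>
    (\<forall>n. \<exists>m. \<forall>r\<in>{1 - 1 / real (m + 2)<..<1}. \<forall>s\<in>{1 - 1 / real (m + 2)<..<1}.
       dist (h r) (h s) \<le> 1 / real (Suc n))" (is "?L \<longleftrightarrow> ?R")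
proof
  assume ?L
  then obtain l where l: "(h \<longlongrightarrow> l) (at_left 1)" by blast
  show ?R
  proof
    fix n
    have "\<forall>\<^sub>F r in at_left 1. dist (h r) l < 1 / real (Suc n) / 2"
      using l by (rule tendstoD) simp
    then obtain b where b: "b < 1" "\<And>r. b < r \<Longrightarrow> r < 1 \<Longrightarrow> dist (h r) l < 1 / real (Suc n) / 2"
      by (auto simp: eventually_at_left[of 0 "1::real"])
    obtain m where m: "inverse (real (Suc m)) < 1 - b"
      using reals_Archimedean[of "1 - b"] b by auto
    have "1 / real (m + 2) \<le> inverse (real (Suc m))"
      by (simp add: field_simps)
    with m have mb: "b < 1 - 1 / real (m + 2)" by linarith
    have "dist (h r) (h s) \<le> 1 / real (Suc n)"
      if "r \<in> {1 - 1 / real (m + 2)<..<1}" "s \<in> {1 - 1 / real (m + 2)<..<1}" for r s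
    proof -
      have "dist (h r) l < 1 / real (Suc n) / 2" "dist (h s) l < 1 / real (Suc n) / 2"
        using that b(2)[of r] b(2)[of s] mb unfolding greaterThanLessThan_iff
        by linarith+
      then show ?thesis
        using dist_triangle2[of "h r" "h s" l] by linarith
    qed
    then show "\<exists>m. \<forall>r\<in>{1 - 1 / real (m + 2)<..<1}. \<forall>s\<in>{1 - 1 / real (m + 2)<..<1}.
       dist (h r) (h s) \<le> 1 / real (Suc n)"
      by blast
  qed
next
  assume R: ?R
  have "cauchy_filter (filtermap h (at_left 1))"
    unfolding cauchy_filter_metric_filtermap
  proof (intro allI impI)
    fix e :: real assume "e > 0"
    then obtain n where n: "inverse (real (Suc n)) < e"
      using reals_Archimedean by blast
    obtain m where m: "\<forall>r\<in>{1 - 1 / real (m + 2)<..<1}. \<forall>s\<in>{1 - 1 / real (m + 2)<..<1}.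
       dist (h r) (h s) \<le> 1 / real (Suc n)"
      using R by blast
    have "\<forall>\<^sub>F r in at_left 1. r \<in> {1 - 1 / real (m + 2)<..<1}"
      by (rule eventually_at_leftI[of "1 - 1 / real (m + 2)"]) auto
    moreover have "dist (h r) (h s) < e"
      if "r \<in> {1 - 1 / real (m + 2)<..<1}" "s \<in> {1 - 1 / real (m + 2)<..<1}" for r s
      using m[rule_format, OF that] n by (simp add: inverse_eq_divide)
    ultimately show "\<exists>P. eventually P (at_left 1) \<and> (\<forall>x y. P x \<and> P y \<longrightarrow> dist (h x) (h y) < e)"
      by blast
  qed
  moreover have "filtermap h (at_left 1) \<noteq> bot"
    by (simp add: filtermap_bot_iff)
  moreover have "\<forall>G\<le>principal UNIV. G \<noteq> bot \<longrightarrow> cauchy_filter G \<longrightarrow> (\<exists>x\<in>(UNIV::complex set). G \<le> nhds x)"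
    using complete_UNIV[where 'a = complex] unfolding complete_uniform .
  ultimately obtain l where "filtermap h (at_left 1) \<le> nhds l"
    by (simp del: filtermap_bot_iff) blast
  then show ?L
    by (auto simp: filterlim_def)
qed

lemma borel_radial_limit_dom:
  assumes "continuous_on (ball 0 1) \<phi>"
  shows "radial_limit_dom \<phi> \<in> sets borel"
proof -
  define C where "C n m = {\<xi> \<in> sphere 0 1. \<forall>r\<in>{1 - 1 / real (m + 2)<..<1}.
    \<forall>s\<in>{1 - 1 / real (m + 2)<..<1}.
      dist (\<phi> (of_real r * \<xi>)) (\<phi> (of_real s * \<xi>)) \<le> 1 / real (Suc n)}" for n m
  have pos: "0 < r" if "r \<in> {1 - 1 / real (m + 2)<..<1}" for r m
  proof -
    have "1 / real (m + 2) \<le> 1" by simp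
    then show ?thesis using that unfolding greaterThanLessThan_iff by linarith
  qed
  have "closed (C n m)" for n m
  proof -
    have "closed {\<xi> \<in> sphere 0 1.
        dist (\<phi> (of_real r * \<xi>)) (\<phi> (of_real s * \<xi>)) \<le> 1 / real (Suc n)}"
      if "r \<in> {1 - 1 / real (m + 2)<..<1}" "s \<in> {1 - 1 / real (m + 2)<..<1}" for r s
      using pos[OF that(1)] pos[OF that(2)] that
      by (intro continuous_on_closed_Collect_le continuous_intros continuous_on_radial[OF assms])
        auto
    then have "closed (sphere 0 1 \<inter> (\<Inter>r\<in>{1 - 1 / real (m + 2)<..<1}. 
        \<Inter>s\<in>{1 - 1 / real (m + 2)<..<1}. {\<xi> \<in> sphere 0 1.
        dist (\<phi> (of_real r * \<xi>)) (\<phi> (of_real s * \<xi>)) \<le> 1 / real (Suc n)}))"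
      by (intro closed_Int closed_INT ballI closed_sphere)
    also have "\<dots> = C n m"
      by (auto simp: C_def)
    finally show ?thesis .
  qed
  then have "(\<Inter>n. \<Union>m. C n m) \<in> sets borel"
    by (intro sets.countable_INT' sets.countable_UN image_subsetI borel_closed) simp_all
  also have "(\<Inter>n. \<Union>m. C n m) = radial_limit_dom \<phi>"
    unfolding radial_limit_dom_def convergent_at_left_iff C_def by auto
  finally show ?thesis .
qed

lemma radial_limit_in_frontier:
  assumes "riemann_map U \<phi>" "\<xi> \<in> radial_limit_dom \<phi>"
  shows "radial_limit \<phi> \<xi> \<in> frontier U"
proof -
  let ?l = "radial_limit \<phi> \<xi>"
  have hol: "\<phi> holomorphic_on ball 0 1" and inj: "inj_on \<phi> (ball 0 1)" and U: "\<phi> ` ball 0 1 = U"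
    using assms by (auto simp: riemann_map_def bij_betw_def)
  have \<xi>: "cmod \<xi> = 1" using assms by (auto simp: radial_limit_dom_def)
  have lim: "((\<lambda>r. \<phi> (of_real r * \<xi>)) \<longlongrightarrow> ?l) (at_left 1)"
    using assms(2) by (rule tendsto_radial_limit)
  have ev: "\<forall>\<^sub>F r in at_left 1. complex_of_real r * \<xi> \<in> ball 0 1"
    by (rule eventually_at_leftI[of 0]) (auto simp: norm_mult \<xi>)
  obtain g where g: "g holomorphic_on U" "\<And>z. z \<in> ball 0 1 \<Longrightarrow> g (\<phi> z) = z"
  proof (rule holomorphic_has_inverse[OF hol open_ball inj, unfolded U], goal_cases)
    case (1 g)
    show thesis by (rule that[OF 1(2,4)])
  qed
  have "open U"
    using open_mapping_thm3[OF hol open_ball inj] U by simp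
  have "\<forall>\<^sub>F r in at_left 1. \<phi> (of_real r * \<xi>) \<in> closure U"
    by (rule eventually_mono[OF ev]) (use U in \<open>blast intro: subsetD[OF closure_subset]\<close>)
  then have "?l \<in> closure U"
    by (rule Lim_in_closed_set[OF closed_closure _ _ lim]) simp
  moreover have "?l \<notin> U"
  proof
    assume l: "?l \<in> U"
    have "isCont g ?l"
      using holomorphic_on_imp_continuous_on[OF g(1)] \<open>open U\<close> l
      by (simp add: continuous_on_eq_continuous_at)
    then have "((\<lambda>r. g (\<phi> (of_real r * \<xi>))) \<longlongrightarrow> g ?l) (at_left 1)"
      using lim by (rule isCont_tendsto_compose)
    then have "((\<lambda>r. of_real r * \<xi>) \<longlongrightarrow> g ?l) (at_left 1)"
      by (rule Lim_transform_eventually) (rule eventually_mono[OF ev], rule g(2))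
    moreover have "((\<lambda>r. complex_of_real r * \<xi>) \<longlongrightarrow> of_real 1 * \<xi>) (at_left 1)"
      by (intro tendsto_intros)
    ultimately have "g ?l = \<xi>"
      using tendsto_unique[OF trivial_limit_at_left_real] by fastforce
    moreover have "g ?l \<in> ball 0 1"
      using l U g(2) by force
    ultimately show False using \<xi> by simp
  qed
  ultimately show ?thesis
    using \<open>open U\<close> by (simp add: frontier_def interior_open)
qed

lemma measurable_radial_limit:
  assumes "riemann_map U \<phi>"
  shows "radial_limit \<phi> \<in>
    restrict_space circle_measure (radial_limit_dom \<phi>) \<rightarrow>\<^sub>M restrict_space borel (frontier U)"
proof (rule measurable_restrict_space2)
  have cont: "continuous_on (ball 0 1) \<phi>"
    using assms by (auto simp: riemann_map_def intro: holomorphic_on_imp_continuous_on)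
  show "radial_limit \<phi> \<in> space (restrict_space circle_measure (radial_limit_dom \<phi>)) \<rightarrow> frontier U"
    using radial_limit_in_frontier[OF assms]
    by (auto simp: space_restrict_space circle_measure_def)
  have sets: "sets (restrict_space circle_measure (radial_limit_dom \<phi>)) =
      sets (restrict_space borel (radial_limit_dom \<phi>))"
    by (intro sets_restrict_space_cong) (simp add: circle_measure_def)
  define r where "r n = 1 - 1 / real (n + 2)" for n
  have r: "0 < r n" "r n < 1" for n
    by (auto simp: r_def field_simps)
  have "r \<longlonglongrightarrow> 1 - 0"
    unfolding r_def by (intro tendsto_intros LIMSEQ_ignore_initial_segment[OF lim_1_over_n])
  then have rlim: "filterlim r (at_left 1) sequentially"
    using r by (auto simp: filterlim_at less_imp_neq)
  have sub: "radial_limit_dom \<phi> \<subseteq> sphere 0 1"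
    by (auto simp: radial_limit_dom_def)
  have "radial_limit \<phi> \<in> borel_measurable (restrict_space borel (radial_limit_dom \<phi>))"
  proof (rule borel_measurable_LIMSEQ_metric)
    show "(\<lambda>\<xi>. \<phi> (of_real (r n) * \<xi>)) \<in> borel_measurable (restrict_space borel (radial_limit_dom \<phi>))"
      for n
      by (rule borel_measurable_continuous_on_restrict)
        (rule continuous_on_subset[OF continuous_on_radial[OF cont r] sub])
    show "(\<lambda>n. \<phi> (of_real (r n) * \<xi>)) \<longlonglongrightarrow> radial_limit \<phi> \<xi>"
      if "\<xi> \<in> space (restrict_space borel (radial_limit_dom \<phi>))" for \<xi>
      using filterlim_compose[OF tendsto_radial_limit rlim] that by (simp add: space_restrict_space)
  qed
  then show "radial_limit \<phi> \<in> borel_measurable (restrict_space circle_measure (radial_limit_dom \<phi>))"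
    using measurable_cong_sets[OF sets refl] by blast
qed

lemma emeasure_harmonic_measure:
  assumes "simply_connected_domain U" "z \<in> U" "A \<in> sets borel" "A \<subseteq> frontier U"
  shows "emeasure (harmonic_measure U z) A = emeasure circle_measure
    {\<xi> \<in> radial_limit_dom (riemann_map_at U z). radial_limit (riemann_map_at U z) \<xi> \<in> A}"
proof -
  define \<phi> where "\<phi> = riemann_map_at U z"
  have \<phi>: "riemann_map U \<phi>"
    unfolding \<phi>_def by (rule riemann_map_at[OF assms(1,2)])
  then have dom: "radial_limit_dom \<phi> \<in> sets borel"
    by (auto simp: riemann_map_def intro!: borel_radial_limit_dom holomorphic_on_imp_continuous_on)
  have A: "A \<in> sets (restrict_space borel (frontier U))"
    using assms(3,4) by (auto simp: sets_restrict_space)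
  have sp: "space circle_measure = UNIV" "sets circle_measure = sets borel"
    by (auto simp: circle_measure_def)
  have "emeasure (harmonic_measure U z) A =
      emeasure (restrict_space circle_measure (radial_limit_dom \<phi>))
        (radial_limit \<phi> -` A \<inter> radial_limit_dom \<phi>)"
    using emeasure_distr[OF measurable_radial_limit[OF \<phi>] A]
    by (simp add: harmonic_measure_def \<phi>_def[symmetric] space_restrict_space sp)
  also have "\<dots> = emeasure circle_measure (radial_limit \<phi> -` A \<inter> radial_limit_dom \<phi>)"
    by (rule emeasure_restrict_space) (use dom sp in auto)
  also have "radial_limit \<phi> -` A \<inter> radial_limit_dom \<phi> = {\<xi> \<in> radial_limit_dom \<phi>. radial_limit \<phi> \<xi> \<in> A}"
    by auto
  finally show ?thesis
    by (simp add: \<phi>_def)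
qed

end

theory Submission
  imports Defs
begin

text \<open>
  Let \<open>G\<close> map the disc holomorphically into a simply connected domain \<open>V\<close>, and let \<open>d\<close> be the distance from \<open>G 0\<close> to the
  boundary. Every circle around \<open>G 0\<close> of radius \<open>\<rho> \<ge> d\<close> contains a point \<open>x\<close> outside \<open>V\<close>. As \<open>x - G\<close> has no zeros,
  Jensen's formula gives mean \<open>0\<close> for \<open>ln (\<bar>x - G\<bar> / \<rho>)\<close> on circles around \<open>0\<close>, and so mean at most \<open>0\<close> for
  \<open>ln \<bar>1 - m / \<rho>\<bar>\<close>, where \<open>m = \<bar>G - G 0\<bar>\<close>. Averaging over \<open>\<rho>\<close> with a suitable Poisson kernel turns this into
  \<open>ln (\<bar>T + sqrt (1 - m / d)\<bar> / (T + 1))\<close>, whence \<open>m \<ge> d (1 + T\<^sup>2)\<close> only on a set of measure \<open>O(1 / T)\<close>. Thus \<open>m > e\<close> has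
  measure \<open>O(sqrt (d / e))\<close>.

  With \<open>G = F n \<circ> \<phi>\<close>, where \<open>\<phi>\<close> is a Riemann map of \<open>U\<close>, the Borel--Cantelli lemma shows that almost all boundary values
  of \<open>F n\<close> approach \<open>F n z\<close>. Schottky's theorem bounds \<open>\<bar>F n z - F n w\<bar>\<close> by a multiple of the distance from \<open>F n z\<close> to the
  boundary, so the choice of the base point is immaterial.
\<close>

subsection \<open>Mean values over the unit circle\<close>

text \<open>Circle means are taken over angles, so that they can be compared with contour integrals
  over \<open>{0..2 * pi}\<close>.\<close>

definition angle_measure :: "real measure" where
  "angle_measure = uniform_measure lborel {0..<2 * pi}"

lemma sets_angle_measure [simp, measurable_cong]: "sets angle_measure = sets borel"
  and space_angle_measure [simp]: "space angle_measure = UNIV"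
  by (simp_all add: angle_measure_def)

lemma emeasure_angle_measure_UNIV: "emeasure angle_measure UNIV = 1"
  by (simp add: angle_measure_def divide_eq_1_iff flip: ennreal_numeral)

lemma finite_measure_angle_measure: "finite_measure angle_measure"
  by (rule finite_measureI) (simp add: emeasure_angle_measure_UNIV)

interpretation angle: finite_measure angle_measure
  by (rule finite_measure_angle_measure)

lemma measure_angle_measure_UNIV [simp]: "measure angle_measure UNIV = 1"
  by (simp add: measure_def emeasure_angle_measure_UNIV)

lemma circle_measure_eq: "circle_measure = distr angle_measure borel cis"
  by (simp add: circle_measure_def angle_measure_def)

lemma integrable_circle:
  fixes f :: "complex \<Rightarrow> 'b :: {banach, second_countable_topology}"
  assumes "continuous_on (sphere 0 1) f"
  shows "integrable angle_measure (\<lambda>t. f (cis t))"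
proof -
  have "compact (f ` sphere 0 1)"
    by (rule compact_continuous_image[OF assms]) simp
  then obtain B where "\<And>u. u \<in> sphere 0 1 \<Longrightarrow> norm (f u) \<le> B"
    by (meson bounded_iff compact_imp_bounded imageI)
  moreover have "continuous_on UNIV (\<lambda>t. f (cis t))"
    by (rule continuous_on_compose2[OF assms]) (auto intro!: continuous_intros)
  then have "(\<lambda>t. f (cis t)) \<in> borel_measurable angle_measure"
    using borel_measurable_continuous_onI by (simp add: measurable_def)
  ultimately show ?thesis
    by (intro angle.integrable_const_bound[of _ B]) auto
qed

lemma integral_angle_measure:
  fixes f :: "real \<Rightarrow> 'b :: euclidean_space"
  assumes "continuous_on UNIV f"
  shows "integral\<^sup>L angle_measure f = (1 / (2 * pi)) *\<^sub>R integral {0..2 * pi} f"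
proof -
  have f: "f \<in> borel_measurable borel"
    using assms by (rule borel_measurable_continuous_onI)
  have d: "angle_measure = density lborel (\<lambda>x. ennreal (indicator {0..<2 * pi} x / (2 * pi)))"
    unfolding angle_measure_def uniform_measure_def
    by (auto intro!: density_cong AE_I2 simp: divide_ennreal ennreal_indicator[symmetric] split: split_indicator)
  have "integral\<^sup>L angle_measure f = (\<integral>x. (indicator {0..<2 * pi} x / (2 * pi)) *\<^sub>R f x \<partial>lborel)"
    unfolding d using f by (intro integral_density) auto
  also have "\<dots> = (\<integral>x. (1 / (2 * pi)) *\<^sub>R (indicator {0..2 * pi} x *\<^sub>R f x) \<partial>lborel)"
  proof (rule integral_cong_AE)
    show "AE x in lborel. (indicator {0..<2 * pi} x / (2 * pi)) *\<^sub>R f x =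
        (1 / (2 * pi)) *\<^sub>R (indicator {0..2 * pi} x *\<^sub>R f x)"
      using AE_lborel_singleton[of "2 * pi"] by eventually_elim (auto split: split_indicator)
  qed (use f in measurable)
  also have "\<dots> = (1 / (2 * pi)) *\<^sub>R (\<integral>x. indicator {0..2 * pi} x *\<^sub>R f x \<partial>lborel)"
    by (rule integral_scaleR_right)
  also have "(\<integral>x. indicator {0..2 * pi} x *\<^sub>R f x \<partial>lborel) = integral {0..2 * pi} f"
    using set_borel_integral_eq_integral(2)[of "{0..2 * pi}" f]
      borel_integrable_compact[of "{0..2*pi}" f] assms continuous_on_subset
    by (auto simp: set_lebesgue_integral_def set_integrable_def)
  finally show ?thesis .
qed

text \<open>Cauchy's formula at the centre: on a circle around \<open>0\<close>,
  \<open>du / u = \<i> dt\<close>.\<close>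

lemma holomorphic_mean_value:
  assumes "f holomorphic_on ball 0 R" "0 < r" "r < R"
  shows "(\<integral>t. f (of_real r * cis t) \<partial>angle_measure) = f 0"
proof -
  have "cball 0 r \<subseteq> ball (0::complex) R"
    using assms by auto
  then have hol: "f holomorphic_on cball 0 r"
    using assms holomorphic_on_subset by blast
  have "((\<lambda>u. f u / (u - 0)) has_contour_integral (2 * of_real pi * \<i> * f 0)) (circlepath 0 r)"
    by (rule Cauchy_integral_circlepath_simple[OF hol]) (use assms in auto)
  then have "((\<lambda>t. f (0 + r * cis t) / (0 + r * cis t - 0) * r * \<i> * cis t) has_integral 
      (2 * of_real pi * \<i> * f 0)) {0..2 * pi}"
    unfolding circlepath_def by (subst (asm) has_contour_integral_part_circlepath_iff) auto
  then have "((\<lambda>t. \<i> * f (of_real r * cis t)) has_integral (2 * of_real pi * \<i> * f 0)) {0..2 * pi}"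
    by (rule has_integral_eq[rotated]) (use assms in auto)
  have i1: "- \<i> * (\<i> * w) = w" and i2: "- \<i> * (2 * of_real pi * \<i> * w) = 2 * of_real pi * w" for w
    by (simp_all add: mult.assoc[symmetric])
  from has_integral_mult_right[OF \<open>((\<lambda>t. \<i> * f (of_real r * cis t)) has_integral _) _\<close>, of "- \<i>"]
  have I: "((\<lambda>t. f (of_real r * cis t)) has_integral (2 * of_real pi * f 0)) {0..2 * pi}"
    by (simp only: i1 i2)
  have "continuous_on UNIV (\<lambda>t. f (of_real r * cis t))"
    by (rule continuous_on_compose2[OF holomorphic_on_imp_continuous_on[OF hol]])
       (use assms in \<open>auto intro!: continuous_intros simp: norm_mult\<close>)
  from integral_angle_measure[OF this] integral_unique[OF I]
  show ?thesis
    by (simp add: scaleR_conv_of_real)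
qed

text \<open>A zero-free function on a disc has a holomorphic logarithm \<open>g\<close>, and
  \<open>ln |f| = Re g\<close> inherits the mean value property.\<close>

lemma ln_norm_mean_value:
  assumes "f holomorphic_on ball 0 R" "\<And>z. z \<in> ball 0 R \<Longrightarrow> f z \<noteq> 0" "0 < r" "r < R"
  shows "(\<integral>t. ln (cmod (f (of_real r * cis t))) \<partial>angle_measure) = ln (cmod (f 0))"
proof -
  obtain g where g: "g holomorphic_on ball 0 R" "\<And>z. z \<in> ball 0 R \<Longrightarrow> exp (g z) = f z"
    using holomorphic_logarithm_exists[of "ball 0 R" f 0] assms by auto
  have ln: "ln (cmod (f z)) = Re (g z)" if "z \<in> ball 0 R" for z
    using g(2)[OF that] by (metis norm_exp_eq_Re ln_exp)
  have "continuous_on (sphere 0 1) (\<lambda>u. g (of_real r * u))"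
    by (rule continuous_on_compose2[OF holomorphic_on_imp_continuous_on[OF g(1)]])
       (use assms in \<open>auto intro!: continuous_intros simp: norm_mult\<close>)
  then have "integrable angle_measure (\<lambda>t. g (of_real r * cis t))"
    by (rule integrable_circle)
  from integral_Re[OF this] holomorphic_mean_value[OF g(1) assms(3,4)]
  have "(\<integral>t. Re (g (of_real r * cis t)) \<partial>angle_measure) = Re (g 0)"
    by simp
  moreover have "ln (cmod (f (of_real r * cis t))) = Re (g (of_real r * cis t))" for t
    by (rule ln) (use assms in \<open>auto simp: norm_mult\<close>)
  ultimately show ?thesis
    using ln[of 0] assms by simp
qed

text \<open>Any zero of \<open>b - a * z\<close> lies outside the closed unit disc, so there is a
  larger disc without zeros, of radius \<open>cmod b / cmod a\<close> for
  \<open>a \<noteq> 0\<close>.\<close>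

lemma ln_norm_affine_mean_value:
  assumes "cmod a < cmod b"
  shows "(\<integral>t. ln (cmod (b - a * cis t)) \<partial>angle_measure) = ln (cmod b)"
proof -
  have nz: "b - a * z \<noteq> 0" if "z \<in> ball 0 (cmod b / cmod a)" for z
  proof
    assume "b - a * z = 0"
    then have eq: "cmod b = cmod a * cmod z"
      by (metis eq_iff_diff_eq_0 norm_mult)
    then have "cmod a \<noteq> 0"
      using assms by auto
    then show False
      using eq that by (simp add: field_simps)
  qed
  show ?thesis
  \<comment> \<open>For \<open>a = 0\<close> the quotient \<open>cmod b / cmod a\<close> is
    \<open>0\<close> by convention, but then the integrand is constant.\<close>
  proof (cases "a = 0")
    case False
    then show ?thesis
      using ln_norm_mean_value[of "\<lambda>z. b - a * z" "cmod b / cmod a" 1] nz assms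
      by (simp add: holomorphic_intros)
  qed auto
qed

section \<open>Distance to the boundary of a simply connected domain\<close>

text \<open>\<open>infdist\<close> to the empty set is \<open>0\<close> by convention; this excludes
  that case.\<close>

lemma frontier_nonempty:
  assumes "simply_connected_domain V"
  shows "frontier V \<noteq> {}"
  using assms frontier_eq_empty[of V] by (auto simp: simply_connected_domain_def)

lemma infdist_frontier_pos:
  assumes "simply_connected_domain V" "w \<in> V"
  shows "infdist w (frontier V) > 0"
proof -
  have "w \<notin> frontier V"
    using assms by (auto simp: simply_connected_domain_def frontier_def interior_open)
  then show ?thesis
    using frontier_nonempty[OF assms(1)] by (simp add: infdist_pos_not_in_closed)
qed

text \<open>A circle inside \<open>V\<close> would wind once around the nearest boundary point
  \<open>a\<close>, which is outside \<open>V\<close>; simple connectivity makes this winding number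
  \<open>0\<close>.\<close>

lemma circle_meets_complement:
  assumes V: "simply_connected_domain V" and "infdist w (frontier V) \<le> \<rho>"
  obtains x where "x \<notin> V" "dist w x = \<rho>"
proof -
  obtain a where a: "a \<in> frontier V" "infdist w (frontier V) = dist w a"
    using infdist_attains_inf[of "frontier V" w] frontier_nonempty[OF V] by auto
  have aV: "a \<notin> V"
    using a V by (auto simp: simply_connected_domain_def frontier_def interior_open)
  show ?thesis
  proof (cases "dist w a = \<rho>")
    case False
    then have less: "dist w a < \<rho>"
      using a assms by simp
    then have pos: "\<rho> > 0"
      using zero_le_dist[of w a] by linarith
    have "\<exists>x. x \<notin> V \<and> dist w x = \<rho>"
    proof (rule ccontr)
      assume "\<nexists>x. x \<notin> V \<and> dist w x = \<rho>"
      then have "path_image (circlepath w \<rho>) \<subseteq> V"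
        using pos by (auto simp: path_image_circlepath)
      then have "winding_number (circlepath w \<rho>) a = 0"
        using V aV by (intro simply_connected_imp_winding_number_zero[of V])
          (auto simp: simply_connected_domain_def)
      moreover have "winding_number (circlepath w \<rho>) a = 1"
        by (rule winding_number_circlepath) (use less in \<open>simp add: dist_norm norm_minus_commute\<close>)
      ultimately show False by simp
    qed
    then show ?thesis using that by blast
  qed (use that aV in blast)
qed

text \<open>Up to a factor, the map \<open>u \<mapsto> T (u - 1) / (u + 1)\<close> takes the unit circle to the imaginary axis, and the two
  factors are \<open>T (u - 1) \<plusminus> s (u + 1)\<close>. Squaring the right half-plane gives a slit plane, the extremal domain for
  Beurling's estimate; in the applications \<open>s\<^sup>2\<close> is real.\<close>

definition slit_kernel :: "real \<Rightarrow> complex \<Rightarrow> complex \<Rightarrow> real" where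
  "slit_kernel T s u = cmod ((of_real T + s) * u - (of_real T - s)) * cmod ((of_real T + s) - (of_real T - s) * u)"

text \<open>On the unit circle \<open>(u + 1)\<^sup>2\<close> and \<open>(u - 1)\<^sup>2\<close> are
  real multiples of \<open>u\<close>, hence so is the product of the two factors.\<close>

lemma slit_kernel_unit:
  assumes "cmod u = 1" "s\<^sup>2 = of_real c"
  shows "slit_kernel T s u = \<bar>T\<^sup>2 * (cmod (u - 1))\<^sup>2 + c * (cmod (u + 1))\<^sup>2\<bar>"
proof -
  have u: "u * cnj u = 1"
    using complex_norm_square[of u] assms by simp
  have "((of_real T + s) * u - (of_real T - s)) * ((of_real T + s) - (of_real T - s) * u) =
      s\<^sup>2 * (u + 1)\<^sup>2 - (of_real T)\<^sup>2 * (u - 1)\<^sup>2"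
    by (simp add: algebra_simps power2_eq_square)
  also have "(u + 1)\<^sup>2 = u * of_real ((cmod (u + 1))\<^sup>2)"
    unfolding complex_norm_square complex_cnj_add complex_cnj_one using u by algebra
  also have "(u - 1)\<^sup>2 = - u * of_real ((cmod (u - 1))\<^sup>2)"
    unfolding complex_norm_square complex_cnj_diff complex_cnj_one using u by algebra
  also have "s\<^sup>2 * (u * of_real ((cmod (u + 1))\<^sup>2)) - (of_real T)\<^sup>2 * (- u * of_real ((cmod (u - 1))\<^sup>2)) =
      u * of_real (T\<^sup>2 * (cmod (u - 1))\<^sup>2 + c * (cmod (u + 1))\<^sup>2)"
    unfolding assms(2) by (simp add: algebra_simps)
  finally have "cmod (((of_real T + s) * u - (of_real T - s)) * ((of_real T + s) - (of_real T - s) * u)) =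
      cmod u * cmod (of_real (T\<^sup>2 * (cmod (u - 1))\<^sup>2 + c * (cmod (u + 1))\<^sup>2))"
    by (simp only: norm_mult)
  then show ?thesis
    unfolding slit_kernel_def norm_mult norm_of_real using assms by simp
qed

text \<open>Keeps the zeros of both kernel factors off the unit circle: that of the first lies
  inside, any zero of the second outside.\<close>

lemma norm_diff_less_norm_add:
  assumes "T > 0" "Re s > 0"
  shows "cmod (of_real T - s) < cmod (of_real T + s)"
proof -
  have "(cmod (of_real T - s))\<^sup>2 < (cmod (of_real T + s))\<^sup>2"
    unfolding cmod_power2 using mult_pos_pos[OF assms] by (simp add: power2_eq_square algebra_simps)
  then show ?thesis
    by (rule power2_less_imp_less) simp
qed

lemma slit_kernel_pos:
  assumes "T > 0" "Re s > 0" "cmod u = 1"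
  shows "slit_kernel T s u > 0"
proof -
  have less: "cmod (of_real T - s) < cmod (of_real T + s)"
    by (rule norm_diff_less_norm_add) fact+
  then have "cmod ((of_real T - s) * u) < cmod (of_real T + s)" "cmod (of_real T - s) < cmod ((of_real T + s) * u)"
    using assms by (auto simp: norm_mult)
  then have "(of_real T + s) - (of_real T - s) * u \<noteq> 0" "(of_real T + s) * u - (of_real T - s) \<noteq> 0"
    by auto
  then show ?thesis
    by (simp add: slit_kernel_def)
qed

lemma continuous_on_slit_kernel [continuous_intros]:
  "continuous_on S (slit_kernel T s)"
  unfolding slit_kernel_def by (intro continuous_intros)

text \<open>On the circle each factor has the modulus of some \<open>b - a * u\<close> with
  \<open>|a| < |b|\<close> and contributes \<open>ln |b|\<close>.\<close>

lemma ln_slit_kernel_mean_value: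
  assumes "T > 0" "Re s > 0"
  shows "(\<integral>t. ln (slit_kernel T s (cis t)) \<partial>angle_measure) = 2 * ln (cmod (of_real T + s))"
proof -
  define a b where "a = of_real T - s" and "b = of_real T + s"
  have ab: "cmod a < cmod b"
    unfolding a_def b_def by (rule norm_diff_less_norm_add) fact+
  have nz: "b - a * u \<noteq> 0" if "cmod a < cmod b" "cmod u = 1" for a b u :: complex
  proof -
    have "cmod (a * u) < cmod b" using that by (simp add: norm_mult)
    then show ?thesis by auto
  qed
  \<comment> \<open>The first factor vanishes inside the disc; conjugation moves the zero outside
    without changing the modulus on the circle.\<close>
  have flip: "cmod (b * cis t - a) = cmod (cnj b - cnj a * cis t)" for t
  proof -
    have "cmod (cnj b - cnj a * cis t) = cmod (cnj (cnj b - cnj a * cis t))"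
      by (rule complex_mod_cnj[symmetric])
    also have "\<dots> = cmod (cis t) * cmod (b - a * cis (- t))"
      by (simp add: cis_cnj)
    also have "\<dots> = cmod (b * cis t - a)"
      unfolding norm_mult[symmetric] by (simp add: algebra_simps cis_mult)
    finally show ?thesis by simp
  qed
  have "ln (slit_kernel T s (cis t)) = ln (cmod (cnj b - cnj a * cis t)) + ln (cmod (b - a * cis t))" for t
    unfolding slit_kernel_def a_def[symmetric] b_def[symmetric] flip
    using nz[of a b] nz[of "cnj a" "cnj b"] ab by (simp add: ln_mult)
  then have "(\<integral>t. ln (slit_kernel T s (cis t)) \<partial>angle_measure) =
     (\<integral>t. ln (cmod (cnj b - cnj a * cis t)) + ln (cmod (b - a * cis t)) \<partial>angle_measure)"
    by simp
  also have "\<dots> = (\<integral>t. ln (cmod (cnj b - cnj a * cis t)) \<partial>angle_measure) + (\<integral>t. ln (cmod (b - a * cis t)) \<partial>angle_measure)"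
    by (intro Bochner_Integration.integral_add integrable_circle[of "\<lambda>u. ln (cmod (cnj b - cnj a * u))"]
          integrable_circle[of "\<lambda>u. ln (cmod (b - a * u))"] continuous_intros)
       (use nz[of a b] nz[of "cnj a" "cnj b"] ab in auto)
  finally show ?thesis
    using ln_norm_affine_mean_value[of a b] ln_norm_affine_mean_value[of "cnj a" "cnj b"] ab
    unfolding b_def[symmetric] by simp
qed

text \<open>The right-hand side is the difference of the kernel means for \<open>s\<close> and for
  \<open>1\<close>; truncation from below at \<open>c\<close> only increases the integrand.\<close>

lemma ln_max_slit_kernel_mean_ge_pos:
  assumes "T > 0" "Re s > 0" "c > 0"
  shows "(\<integral>t. ln (max (slit_kernel T s (cis t) / slit_kernel T 1 (cis t)) c) \<partial>angle_measure)
           \<ge> 2 * ln (cmod (of_real T + s)) - 2 * ln (T + 1)"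
proof -
  have pos: "slit_kernel T s u > 0" "slit_kernel T 1 u > 0" if "cmod u = 1" for u
    using slit_kernel_pos assms that by auto
  have int: "integrable angle_measure (\<lambda>t. ln (slit_kernel T s (cis t)))" if "Re s > 0" for s
    using slit_kernel_pos[OF assms(1) that]
    by (intro integrable_circle[of "\<lambda>u. ln (slit_kernel T s u)"] continuous_intros) force
  have "cmod (of_real T + 1) = \<bar>T + 1\<bar>"
    using norm_of_real[of "T + 1", where 'a = complex] by simp
  then have norm1: "cmod (of_real T + 1) = T + 1"
    using assms by simp
  have "2 * ln (cmod (of_real T + s)) - 2 * ln (T + 1) =
      (\<integral>t. ln (slit_kernel T s (cis t)) - ln (slit_kernel T 1 (cis t)) \<partial>angle_measure)"
    using Bochner_Integration.integral_diff[OF int[of s] int[of 1]] assms norm1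
      ln_slit_kernel_mean_value[of T s] ln_slit_kernel_mean_value[of T 1] by simp
  also have "\<dots> \<le> (\<integral>t. ln (max (slit_kernel T s (cis t) / slit_kernel T 1 (cis t)) c) \<partial>angle_measure)"
  proof (rule integral_mono)
    show "integrable angle_measure (\<lambda>t. ln (slit_kernel T s (cis t)) - ln (slit_kernel T 1 (cis t)))"
      using int[of s] int[of 1] assms by auto
    show "integrable angle_measure (\<lambda>t. ln (max (slit_kernel T s (cis t) / slit_kernel T 1 (cis t)) c))"
    proof (intro integrable_circle[of "\<lambda>u. ln (max (slit_kernel T s u / slit_kernel T 1 u) c)"] continuous_intros ballI)
      show "slit_kernel T 1 u \<noteq> 0" if "u \<in> sphere 0 1" for u
        using pos(2)[of u] that by simp
      show "max x c \<noteq> 0" for x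
        using assms(3) by (simp add: max_def)
    qed
    show "ln (slit_kernel T s (cis t)) - ln (slit_kernel T 1 (cis t)) \<le>
        ln (max (slit_kernel T s (cis t) / slit_kernel T 1 (cis t)) c)" for t
      using pos[of "cis t"] by (auto simp: ln_divide_pos[symmetric] intro!: ln_mono)
  qed
  finally show ?thesis .
qed

text \<open>For \<open>Re s = 0\<close> the kernel can vanish on the circle, so the estimate is
  obtained as a limit from the right half-plane; the truncation permits dominated
  convergence.\<close>

lemma ln_max_slit_kernel_mean_ge:
  assumes "T > 0" "Re s \<ge> 0" "c > 0"
  shows "(\<integral>t. ln (max (slit_kernel T s (cis t) / slit_kernel T 1 (cis t)) c) \<partial>angle_measure)
           \<ge> 2 * ln (cmod (of_real T + s)) - 2 * ln (T + 1)"
proof (rule LIMSEQ_le)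
  define e where "e n = s + of_real (inverse (real (Suc n)))" for n
  define f where "f s t = ln (max (slit_kernel T s (cis t) / slit_kernel T 1 (cis t)) c)" for s t
  have e: "e \<longlonglongrightarrow> s"
    using tendsto_add[OF tendsto_const tendsto_of_real[OF LIMSEQ_inverse_real_of_nat], of s]
    unfolding e_def by simp
  have Re_e: "Re (e n) > 0" for n
    using assms by (simp add: e_def add_nonneg_pos)
  have pos: "slit_kernel T 1 u > 0" if "cmod u = 1" for u
    using slit_kernel_pos assms that by auto
  show "(\<lambda>n. 2 * ln (cmod (of_real T + e n)) - 2 * ln (T + 1)) \<longlonglongrightarrow> 2 * ln (cmod (of_real T + s)) - 2 * ln (T + 1)"
  proof (intro tendsto_intros e)
    have "Re (of_real T + s) > 0"
      using assms by simp
    then show "cmod (of_real T + s) \<noteq> 0"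
      by (metis less_irrefl norm_eq_zero zero_complex.simps(1))
  qed
  have cont: "continuous_on (sphere 0 1) (\<lambda>u. ln (max (slit_kernel T s u / slit_kernel T 1 u) c))" for s
    using assms pos by (intro continuous_intros) (force simp: less_max_iff_disj)+
  \<comment> \<open>Uniformity in \<open>n\<close> comes from joint continuity on the compact
    product of \<open>insert s (range e)\<close> and the circle.\<close>
  have bound: "\<exists>B. \<forall>n t. norm (f (e n) t) \<le> B"
  proof -
    have "compact (insert s (range e))"
      using e by (rule compact_sequence_with_limit)
    then have c1: "compact (insert s (range e) \<times> sphere (0::complex) 1)"
      by (rule compact_Times) simp
    have k: "continuous_on S (\<lambda>p. slit_kernel T (fst p) (snd p))" "continuous_on S (\<lambda>p. slit_kernel T 1 (snd p))" for S
      unfolding slit_kernel_def by (intro continuous_intros)+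
    have pos': "slit_kernel T 1 (snd p) \<noteq> 0" if "p \<in> insert s (range e) \<times> sphere 0 1" for p
      using pos[of "snd p"] that by auto
    have "max x c \<noteq> 0" for x
      using assms by (simp add: max_def)
    then have "continuous_on (insert s (range e) \<times> sphere (0::complex) 1)
        (\<lambda>p. ln (max (slit_kernel T (fst p) (snd p) / slit_kernel T 1 (snd p)) c))"
      by (intro continuous_on_ln continuous_on_max continuous_on_divide k continuous_on_const pos' ballI)
    from compact_imp_bounded[OF compact_continuous_image[OF this c1]]
    obtain B where "\<forall>x\<in>(\<lambda>p. ln (max (slit_kernel T (fst p) (snd p) / slit_kernel T 1 (snd p)) c)) ` (insert s (range e) \<times> sphere 0 1). norm x \<le> B"
      by (auto simp: bounded_iff)
    then have "norm (f (e n) t) \<le> B" for n t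
      unfolding f_def
      by (rule bspec, intro image_eqI[of _ _ "(e n, cis t)"]) auto
    then show ?thesis by blast
  qed
  then obtain B where B: "\<And>n t. norm (f (e n) t) \<le> B" by blast
  have meas: "f s \<in> borel_measurable angle_measure" for s
    unfolding f_def by (rule borel_measurable_integrable[OF integrable_circle[OF cont]])
  show "(\<lambda>n. integral\<^sup>L angle_measure (f (e n))) \<longlonglongrightarrow> (\<integral>t. ln (max (slit_kernel T s (cis t) / slit_kernel T 1 (cis t)) c) \<partial>angle_measure)"
    unfolding f_def[symmetric]
  proof (rule integral_dominated_convergence[where w = "\<lambda>_. B"])
    have "(\<lambda>n. f (e n) t) \<longlonglongrightarrow> f s t" for t
    proof -
      have "(\<lambda>n. slit_kernel T (e n) (cis t)) \<longlonglongrightarrow> slit_kernel T s (cis t)"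
        unfolding slit_kernel_def by (intro tendsto_intros e)
      then show ?thesis
        unfolding f_def using assms(3) pos[of "cis t"]
        by (intro tendsto_intros) (auto simp: max_def)
    qed
    then show "AE t in angle_measure. (\<lambda>n. f (e n) t) \<longlonglongrightarrow> f s t"
      by blast
  qed (use meas B in auto)
  show "\<exists>N. \<forall>n\<ge>N. 2 * ln (cmod (of_real T + e n)) - 2 * ln (T + 1) \<le> integral\<^sup>L angle_measure (f (e n))"
    unfolding f_def by (intro exI allI impI) (rule ln_max_slit_kernel_mean_ge_pos[OF assms(1) Re_e assms(3)])
qed

subsection \<open>A harmonic measure estimate of Beurling type\<close>

interpretation angle_pair: pair_sigma_finite angle_measure angle_measure ..

lemma Fubini_circle:
  fixes f :: "complex \<times> complex \<Rightarrow> real"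
  assumes f: "continuous_on (sphere 0 1 \<times> sphere 0 1) f"
  shows "(\<integral>u. (\<integral>t. f (cis t, cis u) \<partial>angle_measure) \<partial>angle_measure) =
    (\<integral>t. (\<integral>u. f (cis t, cis u) \<partial>angle_measure) \<partial>angle_measure)"
    and "integrable angle_measure (\<lambda>t. \<integral>u. f (cis t, cis u) \<partial>angle_measure)"
    and "integrable angle_measure (\<lambda>u. \<integral>t. f (cis t, cis u) \<partial>angle_measure)"
proof -
  interpret P: finite_measure "angle_measure \<Otimes>\<^sub>M angle_measure"
    by (rule finite_measure_pair_measure) unfold_locales
  have "compact (f ` (sphere 0 1 \<times> sphere 0 1))"
    by (rule compact_continuous_image[OF f]) (intro compact_Times; simp)
  then obtain B where B: "\<And>p. p \<in> sphere 0 1 \<times> sphere 0 1 \<Longrightarrow> norm (f p) \<le> B"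
    by (meson bounded_iff compact_imp_bounded imageI)
  have "continuous_on UNIV (\<lambda>p. f (cis (fst p), cis (snd p)))"
    by (rule continuous_on_compose2[OF f]) (auto intro!: continuous_intros)
  then have "(\<lambda>p. f (cis (fst p), cis (snd p))) \<in> borel_measurable borel"
    by (rule borel_measurable_continuous_onI)
  also have "borel_measurable borel = borel_measurable (angle_measure \<Otimes>\<^sub>M angle_measure)"
    by (intro measurable_cong_sets refl)
      (simp add: borel_prod[symmetric] cong: sets_pair_measure_cong)
  finally have I: "integrable (angle_measure \<Otimes>\<^sub>M angle_measure) (case_prod (\<lambda>t u. f (cis t, cis u)))"
    unfolding case_prod_beta by (intro P.integrable_const_bound[of _ B] AE_I2 B) auto
  show "(\<integral>u. (\<integral>t. f (cis t, cis u) \<partial>angle_measure) \<partial>angle_measure) =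
    (\<integral>t. (\<integral>u. f (cis t, cis u) \<partial>angle_measure) \<partial>angle_measure)"
    by (rule angle_pair.Fubini_integral[OF I])
  show "integrable angle_measure (\<lambda>t. \<integral>u. f (cis t, cis u) \<partial>angle_measure)"
    by (rule angle_pair.integrable_fst[OF I])
  show "integrable angle_measure (\<lambda>u. \<integral>t. f (cis t, cis u) \<partial>angle_measure)"
    by (rule angle_pair.integrable_snd[OF I])
qed

text \<open>The root \<open>s\<close> has \<open>Re s \<ge> 0\<close>, so
  \<open>|T + s| \<ge> T\<close> and \<open>|T + s|\<^sup>2 \<ge> T\<^sup>2 + |s|\<^sup>2\<close>,
  which is at least \<open>2 * T\<^sup>2\<close> if \<open>a \<le> - T\<^sup>2\<close>. Replacing
  \<open>2 * ln (T + 1)\<close> by \<open>2 * ln T\<close> costs at most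
  \<open>2 / T\<close>.\<close>

lemma ln_norm_csqrt_ge:
  assumes "T > 0"
  shows "2 * ln (cmod (of_real T + csqrt (of_real a))) - 2 * ln (T + 1) \<ge>
    - 2 / T + (if a \<le> - T\<^sup>2 then ln 2 else 0)"
proof -
  define s where "s = csqrt (of_real a)"
  have Re: "Re s \<ge> 0"
    unfolding s_def by (rule Re_csqrt)
  have "Re (of_real T + s) \<le> cmod (of_real T + s)"
    by (rule complex_Re_le_cmod)
  then have ge: "T \<le> cmod (of_real T + s)"
    using Re by simp
  have *: "2 * ln T + (if a \<le> - T\<^sup>2 then ln 2 else 0) \<le> 2 * ln (cmod (of_real T + s))"
  proof (cases "a \<le> - T\<^sup>2")
    case True
    have "(cmod s)\<^sup>2 = \<bar>a\<bar>"
      unfolding s_def norm_power[symmetric] by simp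
    then have "T\<^sup>2 \<le> (cmod s)\<^sup>2"
      using True by auto
    also have "(cmod s)\<^sup>2 + T\<^sup>2 \<le> (cmod (of_real T + s))\<^sup>2"
      unfolding cmod_power2 using Re assms by (simp add: power2_eq_square algebra_simps)
    finally have "2 * T\<^sup>2 \<le> (cmod (of_real T + s))\<^sup>2"
      by simp
    then have "ln (2 * T\<^sup>2) \<le> ln ((cmod (of_real T + s))\<^sup>2)"
      using assms by (intro ln_mono) auto
    then show ?thesis
      using True assms ge by (simp add: ln_mult ln_realpow)
  next
    case False
    then show ?thesis
      using ge assms ln_mono[OF ge assms] by simp
  qed
  have "ln (T + 1) - ln T = ln (1 + 1 / T)"
    using assms by (simp add: ln_divide_pos[symmetric] add_divide_distrib)
  also have "\<dots> \<le> 1 / T"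
    using assms by (intro ln_add_one_self_le_self) auto
  finally show ?thesis
    using * unfolding s_def by linarith
qed

text \<open>For \<open>x\<close> outside \<open>V\<close> at distance \<open>\<rho>\<close> from \<open>G 0\<close>, the mean of the logarithm of \<open>\<bar>x - G\<bar> / \<rho>\<close> is \<open>0\<close>. Replacing
  \<open>x\<close> and \<open>G\<close> by their distances from \<open>G 0\<close> (circular projection) only decreases the integrand. The
  truncation at \<open>\<delta> / (\<delta> + M)\<close>, a lower bound of \<open>\<bar>x - G\<bar> / \<rho>\<close> for all \<open>\<rho>\<close>, keeps the integrand bounded.\<close>

lemma circle_average_ln_le_0:
  assumes V: "simply_connected_domain V"
    and G: "G holomorphic_on ball 0 1" "G ` ball 0 1 \<subseteq> V" and r: "0 < r" "r < 1"
    and \<rho>: "infdist (G 0) (frontier V) \<le> \<rho>"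
    and M: "\<And>u. cmod u = 1 \<Longrightarrow> dist (G 0) (G (of_real r * u)) \<le> M"
    and \<delta>: "\<delta> > 0" "\<And>u x. cmod u = 1 \<Longrightarrow> x \<notin> V \<Longrightarrow> \<delta> \<le> dist x (G (of_real r * u))"
  shows "(\<integral>t. ln (max \<bar>1 - dist (G 0) (G (of_real r * cis t)) / \<rho>\<bar> (\<delta> / (\<delta> + M))) \<partial>angle_measure) \<le> 0"
proof -
  have M0: "0 \<le> M"
    using M[of 1] zero_le_dist[of "G 0"] by (meson norm_one order_trans)
  have \<rho>0: "\<rho> > 0"
    using infdist_frontier_pos[OF V, of "G 0"] G \<rho> by force
  obtain x where x: "x \<notin> V" "dist (G 0) x = \<rho>"
    using circle_meets_complement[OF V \<rho>] .
  \<comment> \<open>Zero-free because \<open>x\<close> is omitted, and normalised by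
    \<open>h 0 = 1\<close>, so that the mean of \<open>ln |h|\<close> is \<open>0\<close>.\<close>
  define h where "h z = (x - G z) / (x - G 0)" for z
  have xG: "x \<noteq> G z" if "z \<in> ball 0 1" for z
    using x G that by blast
  have hol: "h holomorphic_on ball 0 1"
    unfolding h_def using xG by (intro holomorphic_intros G) auto
  have nz: "h z \<noteq> 0" if "z \<in> ball 0 1" for z
    using xG[OF that] xG[of 0] by (simp add: h_def)
  have "h 0 = 1"
    using xG[of 0] by (simp add: h_def)
  then have mean: "(\<integral>t. ln (cmod (h (of_real r * cis t))) \<partial>angle_measure) = 0"
    using ln_norm_mean_value[OF hol nz r] by simp
  have norm_h: "cmod (h z) = dist x (G z) / \<rho>" for z
    using x(2) by (simp add: h_def norm_divide dist_norm norm_minus_commute)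
  have le: "max \<bar>1 - dist (G 0) (G (of_real r * u)) / \<rho>\<bar> (\<delta> / (\<delta> + M)) \<le> cmod (h (of_real r * u))"
    if u: "cmod u = 1" for u
  proof -
    let ?y = "G (of_real r * u)"
    have 1: "\<bar>\<rho> - dist (G 0) ?y\<bar> \<le> dist x ?y"
      using x(2) dist_triangle[of "G 0" x ?y] dist_triangle[of "G 0" ?y x] by (simp add: dist_commute)
    have "\<bar>1 - dist (G 0) ?y / \<rho>\<bar> = \<bar>\<rho> - dist (G 0) ?y\<bar> / \<rho>"
      using \<rho>0 by (simp add: field_simps abs_if)
    then have a: "\<bar>1 - dist (G 0) ?y / \<rho>\<bar> \<le> dist x ?y / \<rho>"
      using 1 \<rho>0 by (simp add: divide_right_mono)
    have "\<delta> * \<rho> \<le> dist x ?y * (\<delta> + M)"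
    \<comment> \<open>For small \<open>\<rho>\<close> the bound \<open>\<delta>\<close> on the
      distance suffices. For large \<open>\<rho>\<close> the distance is at least
      \<open>\<rho> - M\<close>, and \<open>(\<rho> - M) * (\<delta> + M) - \<delta> * \<rho> = M *
      (\<rho> - \<delta> - M)\<close>.\<close>
    proof (cases "\<rho> \<le> \<delta> + M")
      case True
      then show ?thesis
        using \<delta>(2)[OF u x(1)] \<delta>(1) M0 \<rho>0 by (intro mult_mono) auto
    next
      case False
      have "\<delta> * \<rho> \<le> (\<rho> - M) * (\<delta> + M)"
        using mult_left_mono[of "\<delta> + M" \<rho> M] False M0 by (simp add: algebra_simps)
      also have "\<dots> \<le> dist x ?y * (\<delta> + M)"
        using 1 M[OF u] \<delta>(1) M0 by (intro mult_right_mono) auto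
      finally show ?thesis .
    qed
    then have "\<delta> / (\<delta> + M) \<le> dist x ?y / \<rho>"
      using \<rho>0 \<delta>(1) M0 by (simp add: field_simps)
    with a show ?thesis
      by (simp add: norm_h)
  qed
  have contG: "continuous_on (sphere 0 1) (\<lambda>u. G (of_real r * u))"
    by (rule continuous_on_radial[OF holomorphic_on_imp_continuous_on[OF G(1)] r])
  have conth: "continuous_on (sphere 0 1) (\<lambda>u. h (of_real r * u))"
    by (rule continuous_on_radial[OF holomorphic_on_imp_continuous_on[OF hol] r])
  have c: "\<delta> / (\<delta> + M) > 0"
    using \<delta>(1) M0 by simp
  have "(\<integral>t. ln (max \<bar>1 - dist (G 0) (G (of_real r * cis t)) / \<rho>\<bar> (\<delta> / (\<delta> + M))) \<partial>angle_measure)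
      \<le> (\<integral>t. ln (cmod (h (of_real r * cis t))) \<partial>angle_measure)"
  proof (rule integral_mono)
    show "integrable angle_measure (\<lambda>t. ln (max \<bar>1 - dist (G 0) (G (of_real r * cis t)) / \<rho>\<bar> (\<delta> / (\<delta> + M))))"
      using c \<rho>0 by (intro integrable_circle[of "\<lambda>u. ln (max \<bar>1 - dist (G 0) (G (of_real r * u)) / \<rho>\<bar> (\<delta> / (\<delta> + M)))"]
        continuous_intros contG) (auto simp: max_def)
    show "integrable angle_measure (\<lambda>t. ln (cmod (h (of_real r * cis t))))"
      using r by (intro integrable_circle[of "\<lambda>u. ln (cmod (h (of_real r * u)))"] continuous_intros conth ballI)
         (simp, rule nz, simp add: norm_mult)
    show "ln (max \<bar>1 - dist (G 0) (G (of_real r * cis t)) / \<rho>\<bar> (\<delta> / (\<delta> + M)))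
        \<le> ln (cmod (h (of_real r * cis t)))" for t
      by (rule ln_mono[OF le]) (use c in \<open>auto simp: less_max_iff_disj\<close>)
  qed
  then show ?thesis
    using mean by simp
qed

text \<open>A truncated \<open>ln |1 - q u * m / d|\<close> is integrated over both circles. For
  fixed \<open>u\<close> the radius \<open>d / q u\<close> is at least \<open>d\<close>, so the mean
  over \<open>t\<close> is at most \<open>0\<close>; for fixed \<open>t\<close> the mean over
  \<open>u\<close> is at least \<open>- 2 / T\<close>, plus \<open>ln 2\<close> on the exceptional
  set. Fubini's theorem compares the two.\<close>

lemma beurling_estimate:
  assumes V: "simply_connected_domain V"
    and G: "G holomorphic_on ball 0 1" "G ` ball 0 1 \<subseteq> V" and r: "0 < r" "r < 1" and T: "T > 0"
  shows "measure angle_measure {t. infdist (G 0) (frontier V) * (1 + T\<^sup>2) \<le> dist (G 0) (G (of_real r * cis t))}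
    \<le> 2 / (ln 2 * T)"
proof -
  define d where "d = infdist (G 0) (frontier V)"
  define m where "m u = dist (G 0) (G (of_real r * u))" for u
  have d: "d > 0"
    unfolding d_def using infdist_frontier_pos[OF V, of "G 0"] G by force
  have K: "of_real r * u \<in> cball 0 r" if "cmod u = 1" for u
    using r that by (simp add: norm_mult)
  have contG: "continuous_on (cball 0 r) G"
    using r by (intro continuous_on_subset[OF holomorphic_on_imp_continuous_on[OF G(1)]]) auto
  have comp: "compact (G ` cball 0 r)"
    by (rule compact_continuous_image[OF contG]) simp
  have GV: "G ` cball 0 r \<subseteq> V"
    using G r by fastforce
  obtain M where "\<And>y. y \<in> G ` cball 0 r \<Longrightarrow> dist (G 0) y \<le> M"
    using compact_imp_bounded[OF comp] bounded_any_center[of "G ` cball 0 r" "G 0"] by metis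
  then have M: "m u \<le> M" if "cmod u = 1" for u
    unfolding m_def using K that by blast
  have M0: "0 \<le> M"
    using M[of 1] by (simp add: m_def) (meson order_trans zero_le_dist)
  have "closed (- V)"
    using V by (simp add: simply_connected_domain_def closed_open)
  then obtain \<delta> where \<delta>: "\<delta> > 0" "\<And>x y. x \<in> G ` cball 0 r \<Longrightarrow> y \<in> - V \<Longrightarrow> \<delta> \<le> dist x y"
    using separate_compact_closed[OF comp, of "- V"] GV by blast
  then have \<delta>': "\<delta> \<le> dist x (G (of_real r * u))" if "cmod u = 1" "x \<notin> V" for u x
    using \<delta>(2)[of "G (of_real r * u)" x] K that by (auto simp: dist_commute)
  define c where "c = \<delta> / (\<delta> + M)"
  have c: "0 < c" "c \<le> 1"
    using \<delta>(1) M0 by (auto simp: c_def)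
  \<comment> \<open>The radii are averaged over \<open>\<rho> = d / q u\<close>, which is \<open>d (1 + y\<^sup>2)\<close> with \<open>y\<close> distributed on the line
    according to the Poisson kernel of the half-plane at height \<open>T\<close>.\<close>
  define q where "q u = (cmod (u + 1))\<^sup>2 / slit_kernel T 1 u" for u
  define f where "f p = ln (max \<bar>1 - q (snd p) * m (fst p) / d\<bar> c)" for p
  have pos: "slit_kernel T 1 u > 0" if "cmod u = 1" for u
    using slit_kernel_pos[OF T _ that, of 1] by simp
  have k1: "slit_kernel T 1 u = T\<^sup>2 * (cmod (u - 1))\<^sup>2 + (cmod (u + 1))\<^sup>2" if "cmod u = 1" for u
    using slit_kernel_unit[OF that, of 1 1 T] by simp
  have q: "0 \<le> q u" "q u \<le> 1" if "cmod u = 1" for u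
    using pos[OF that] k1[OF that] by (auto simp: q_def)
  have contm: "continuous_on (sphere 0 1) m"
    unfolding m_def by (intro continuous_intros continuous_on_radial[OF holomorphic_on_imp_continuous_on[OF G(1)] r])
  have contq: "continuous_on (sphere 0 1) q"
    unfolding q_def using pos by (intro continuous_intros) force
  have max_c: "max x c \<noteq> 0" for x
    using c by (simp add: max_def)
  have contf: "continuous_on (sphere 0 1 \<times> sphere 0 1) f"
    unfolding f_def
    by (intro continuous_intros continuous_on_compose2[OF contm] continuous_on_compose2[OF contq])
       (use max_c d in auto)
  have upper: "(\<integral>t. f (cis t, cis u) \<partial>angle_measure) \<le> 0" for u
  \<comment> \<open>Where \<open>q\<close> vanishes the radius would be infinite; the integrand is
    then \<open>ln (max 1 c) = 0\<close> because \<open>c \<le> 1\<close>.\<close>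
  proof (cases "q (cis u) = 0")
    case True
    then show ?thesis
      using c by (simp add: f_def max_def)
  next
    case False
    then have "q (cis u) > 0" using q[of "cis u"] by simp
    then have "d \<le> d / q (cis u)"
      using q[of "cis u"] d by (simp add: field_simps)
    from circle_average_ln_le_0[OF V G r, of "d / q (cis u)" M \<delta>] this \<delta>(1) \<delta>' M
    show ?thesis
      by (simp add: f_def c_def m_def d_def mult.commute)
  qed
  have lower: "(\<integral>u. f (cis t, cis u) \<partial>angle_measure) \<ge> - 2 / T + (if d * (1 + T\<^sup>2) \<le> m (cis t) then ln 2 else 0)" for t
  proof -
    define a where "a = 1 - m (cis t) / d"
    define s where "s = csqrt (of_real a)"
    have s: "s\<^sup>2 = of_real a" "Re s \<ge> 0"
      unfolding s_def using Re_csqrt by auto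
    have eq: "\<bar>1 - q (cis u) * m (cis t) / d\<bar> = slit_kernel T s (cis u) / slit_kernel T 1 (cis u)" for u
    proof -
      have "1 - q (cis u) * m (cis t) / d = (slit_kernel T 1 (cis u) - (cmod (cis u + 1))\<^sup>2 * (m (cis t) / d)) / slit_kernel T 1 (cis u)"
        using pos[of "cis u"] by (simp add: q_def field_simps)
      also have "slit_kernel T 1 (cis u) - (cmod (cis u + 1))\<^sup>2 * (m (cis t) / d) = 
          T\<^sup>2 * (cmod (cis u - 1))\<^sup>2 + a * (cmod (cis u + 1))\<^sup>2"
        using k1[of "cis u"] by (simp add: a_def algebra_simps)
      finally show ?thesis
        using slit_kernel_unit[OF _ s(1), of "cis u" T] pos[of "cis u"] by (simp add: abs_divide)
    qed
    have "d * (1 + T\<^sup>2) \<le> m (cis t) \<longleftrightarrow> a \<le> - T\<^sup>2"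
      using d by (simp add: a_def field_simps)
    then show ?thesis
      using ln_norm_csqrt_ge[OF T, of a] ln_max_slit_kernel_mean_ge[OF T s(2) c(1)]
      unfolding f_def eq s_def fst_conv snd_conv by simp
  qed
  define A where "A = {t. d * (1 + T\<^sup>2) \<le> m (cis t)}"
  have "closed A"
    unfolding A_def
    by (intro closed_Collect_le continuous_on_compose2[OF contm] continuous_intros) auto
  then have A: "A \<in> sets angle_measure"
    by simp
  have "- 2 / T + ln 2 * measure angle_measure A = (\<integral>t. - 2 / T + indicator A t * ln 2 \<partial>angle_measure)"
    using A angle.emeasure_finite[of A] by (subst Bochner_Integration.integral_add) (auto simp: less_top[symmetric])
  also have "\<dots> \<le> (\<integral>t. (\<integral>u. f (cis t, cis u) \<partial>angle_measure) \<partial>angle_measure)"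
  proof (rule integral_mono)
    show "integrable angle_measure (\<lambda>t. - 2 / T + indicator A t * ln 2)"
      using A angle.emeasure_finite[of A] by (auto simp: less_top[symmetric])
    show "- 2 / T + indicator A t * ln 2 \<le> (\<integral>u. f (cis t, cis u) \<partial>angle_measure)" for t
      using lower[of t] by (simp add: A_def indicator_def split: if_splits)
  qed (rule Fubini_circle(2)[OF contf])
  also have "\<dots> = (\<integral>u. (\<integral>t. f (cis t, cis u) \<partial>angle_measure) \<partial>angle_measure)"
    by (rule Fubini_circle(1)[OF contf, symmetric])
  also have "\<dots> \<le> 0"
    using integral_mono[OF Fubini_circle(3)[OF contf] angle.integrable_const[of 0] upper] by simp
  finally have "ln 2 * measure angle_measure A \<le> 2 / T"
    by simp
  then have "measure angle_measure A \<le> 2 / (ln 2 * T)"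
    using T by (simp add: field_simps)
  then show ?thesis
    by (simp add: A_def d_def m_def)
qed

lemma beurling_estimate_sqrt:
  assumes V: "simply_connected_domain V"
    and G: "G holomorphic_on ball 0 1" "G ` ball 0 1 \<subseteq> V" and r: "0 < r" "r < 1" and e: "e > 0"
  shows "measure angle_measure {t. e < dist (G 0) (G (of_real r * cis t))}
    \<le> 2 * sqrt 2 / ln 2 * sqrt (infdist (G 0) (frontier V) / e)"
proof -
  define d where "d = infdist (G 0) (frontier V)"
  \<comment> \<open>Chosen so that \<open>d * (1 + T\<^sup>2) = d + e / 2\<close>, which is at most
    \<open>e\<close> if \<open>2 * d \<le> e\<close>. Otherwise \<open>T \<le> 1\<close> and the
    claimed bound exceeds the total mass \<open>1\<close>.\<close>
  define T where "T = sqrt (e / (2 * d))"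
  have d: "d > 0"
    unfolding d_def using infdist_frontier_pos[OF V, of "G 0"] G by force
  have T: "T > 0" "T\<^sup>2 = e / (2 * d)"
    using d e by (auto simp: T_def)
  have eq: "2 / (ln 2 * T) = 2 * sqrt 2 / ln 2 * sqrt (d / e)"
    using d e by (simp add: T_def real_sqrt_divide real_sqrt_mult field_simps)
  show ?thesis
  proof (cases "2 * d \<le> e")
    case True
    have dT: "d * (1 + T\<^sup>2) \<le> e"
      using True d e by (simp add: T field_simps)
    have "continuous_on UNIV (\<lambda>t. dist (G 0) (G (of_real r * cis t)))"
      by (intro continuous_intros continuous_on_compose2[OF holomorphic_on_imp_continuous_on[OF G(1)]])
         (use r in \<open>auto simp: norm_mult\<close>)
    then have "closed {t. d * (1 + T\<^sup>2) \<le> dist (G 0) (G (of_real r * cis t))}"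
      by (intro closed_Collect_le) auto
    then have "measure angle_measure {t. e < dist (G 0) (G (of_real r * cis t))} \<le>
        measure angle_measure {t. d * (1 + T\<^sup>2) \<le> dist (G 0) (G (of_real r * cis t))}"
      using dT by (intro angle.finite_measure_mono) auto
    also have "\<dots> \<le> 2 / (ln 2 * T)"
      unfolding d_def by (rule beurling_estimate) fact+
    finally show ?thesis
      unfolding eq d_def .
  next
    case False
    have "measure angle_measure {t. e < dist (G 0) (G (of_real r * cis t))} \<le> 1"
      using angle.bounded_measure[of "{t. e < dist (G 0) (G (of_real r * cis t))}"] by simp
    also have "1 \<le> 2 / (ln 2 * T)"
    proof -
      have "T\<^sup>2 \<le> 1\<^sup>2"
        using False d by (simp add: T field_simps)
      then have "T \<le> 1"
        by (rule power2_le_imp_le) simp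
      moreover have "ln 2 \<le> (1::real)"
        using ln_le_minus_one[of "2::real"] by simp
      ultimately have "ln 2 * T \<le> 1 * (1::real)"
        using T by (intro mult_mono) auto
      then show ?thesis
        using T by (simp add: field_simps)
    qed
    finally show ?thesis
      unfolding eq d_def .
  qed
qed

subsection \<open>Approach to the boundary along a sequence of maps\<close>

text \<open>For points \<open>x\<close>, \<open>y\<close> outside \<open>V\<close>, the function
  \<open>(G - x) / (y - x)\<close> omits \<open>0\<close> and \<open>1\<close>, so Schottky's
  theorem bounds it independently of \<open>V\<close> and \<open>G\<close>.\<close>

lemma dist_le_infdist_frontier:
  assumes t: "0 < t" "t < 1"
  obtains C where "C > 0"
    "\<And>V G z. simply_connected_domain V \<Longrightarrow> G holomorphic_on ball 0 1 \<Longrightarrow> G ` ball 0 1 \<subseteq> V \<Longrightarrow>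
       cmod z \<le> t \<Longrightarrow> dist (G 0) (G z) \<le> C * infdist (G 0) (frontier V)"
proof -
  \<comment> \<open>Schottky's theorem needs the closed unit disc, so \<open>G\<close> is rescaled
    by a radius \<open>r\<close> between \<open>t\<close> and \<open>1\<close>; this turns
    \<open>t\<close> into \<open>\<tau> = t / r < 1\<close>.\<close>
  define r where "r = (1 + t) / 2"
  define \<tau> where "\<tau> = t / r"
  have r: "0 < r" "r < 1" and \<tau>: "0 < \<tau>" "\<tau> < 1"
    using t by (auto simp: r_def \<tau>_def field_simps)
  define S where "S = exp (pi * exp (pi * (2 + 2 * 1 + 12 * \<tau> / (1 - \<tau>))))"
  show ?thesis
  proof (rule that[of "1 + 3 * S"])
    show "1 + 3 * S > 0"
      by (simp add: S_def add_pos_pos)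
    fix V G z
    assume V: "simply_connected_domain V" and G: "G holomorphic_on ball 0 1" "G ` ball 0 1 \<subseteq> V"
      and z: "cmod z \<le> t"
    define d where "d = infdist (G 0) (frontier V)"
    have d: "d > 0"
      unfolding d_def using infdist_frontier_pos[OF V, of "G 0"] G by force
    obtain x where x: "x \<notin> V" "dist (G 0) x = d"
      using circle_meets_complement[OF V, of "G 0" d] by (auto simp: d_def)
    \<comment> \<open>The radii \<open>d\<close> and \<open>2 * d\<close> give
      \<open>d \<le> dist y x\<close>, so \<open>x \<noteq> y\<close> and
      \<open>cmod (f 0) \<le> 1\<close>; the bound \<open>dist y x \<le> 3 * d\<close> yields the
      constant \<open>1 + 3 * S\<close>.\<close>
    obtain y where y: "y \<notin> V" "dist (G 0) y = 2 * d"
      using circle_meets_complement[OF V, of "G 0" "2 * d"] d by (auto simp: d_def)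
    have xy: "d \<le> dist y x" "dist y x \<le> 3 * d"
      using dist_triangle[of "G 0" y x] dist_triangle[of y x "G 0"] x y by (auto simp: dist_commute)
    define f where "f w = (G (of_real r * w) - x) / (y - x)" for w
    have mem: "of_real r * w \<in> ball 0 1" if "w \<in> cball 0 1" for w :: complex
    proof -
      have "r * cmod w \<le> r * 1"
        using r that by (intro mult_left_mono) auto
      then have "r * cmod w < 1"
        using r by linarith
      then show ?thesis
        using r by (simp add: norm_mult)
    qed
    have "x \<noteq> y"
      using xy d by auto
    have norm_f: "cmod (f w) = dist (G (of_real r * w)) x / dist y x" for w
      by (simp add: f_def norm_divide dist_norm)
    have "norm (f (z / of_real r)) \<le> S"
      unfolding S_def
    proof (rule Schottky[where f = f and r = 1 and t = \<tau> and z = "z / of_real r"])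
      show "f holomorphic_on cball 0 1"
        unfolding f_def using \<open>x \<noteq> y\<close> mem
        by (intro holomorphic_intros holomorphic_on_compose_gen[OF _ G(1), unfolded o_def]) auto
      show "norm (f 0) \<le> 1"
        using x xy d by (simp add: norm_f divide_le_eq)
      show "\<not> (f w = 0 \<or> f w = 1)" if "w \<in> cball 0 1" for w
      proof -
        have "G (of_real r * w) \<in> V"
          using mem[OF that] G by blast
        then show ?thesis
          using x y \<open>x \<noteq> y\<close> by (auto simp: f_def)
      qed
      show "norm (z / of_real r) \<le> \<tau>"
        using z r by (simp add: norm_divide \<tau>_def divide_right_mono)
    qed fact+
    then have "dist (G z) x \<le> S * dist y x"
      using r xy d \<open>x \<noteq> y\<close> by (simp add: norm_f divide_le_eq)
    also have "\<dots> \<le> S * (3 * d)"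
      using xy by (intro mult_left_mono) (auto simp: S_def)
    finally have "dist (G 0) (G z) \<le> d + S * (3 * d)"
      using dist_triangle[of "G 0" "G z" x] x by (simp add: dist_commute)
    then show "dist (G 0) (G z) \<le> (1 + 3 * S) * infdist (G 0) (frontier V)"
      by (simp add: d_def algebra_simps)
  qed
qed

lemma dist_image_le_infdist_frontier:
  assumes U: "simply_connected_domain U" and zw: "z \<in> U" "w \<in> U"
  obtains C where "C > 0"
    "\<And>V f. simply_connected_domain V \<Longrightarrow> f holomorphic_on U \<Longrightarrow> f ` U \<subseteq> V \<Longrightarrow>
       dist (f z) (f w) \<le> C * infdist (f z) (frontier V)"
proof -
  define \<phi> where "\<phi> = riemann_map_at U z"
  have \<phi>: "\<phi> holomorphic_on ball 0 1" "\<phi> ` ball 0 1 = U" "\<phi> 0 = z"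
    using riemann_map_at[OF U zw(1)] by (auto simp: \<phi>_def riemann_map_def bij_betw_def)
  obtain a where a: "norm a < 1" "\<phi> a = w"
    using \<phi> zw by force
  \<comment> \<open>\<open>norm a\<close> itself would not do as radius, since \<open>a\<close> may
    be \<open>0\<close>.\<close>
  have t: "0 < (1 + norm a) / 2" "(1 + norm a) / 2 < 1"
    using a norm_ge_zero[of a] by (simp_all add: add_pos_nonneg)
  obtain C where C: "C > 0"
    "\<And>V G x. simply_connected_domain V \<Longrightarrow> G holomorphic_on ball 0 1 \<Longrightarrow> G ` ball 0 1 \<subseteq> V \<Longrightarrow>
       cmod x \<le> (1 + norm a) / 2 \<Longrightarrow> dist (G 0) (G x) \<le> C * infdist (G 0) (frontier V)"
    by (rule dist_le_infdist_frontier[OF t]) blast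
  show ?thesis
  proof (rule that[OF C(1)])
    fix V f assume V: "simply_connected_domain V" and f: "f holomorphic_on U" "f ` U \<subseteq> V"
    have "(f \<circ> \<phi>) holomorphic_on ball 0 1"
      using \<phi> f by (intro holomorphic_on_compose) auto
    moreover have "(f \<circ> \<phi>) ` ball 0 1 \<subseteq> V"
      using \<phi> f by (auto simp: image_comp[symmetric])
    ultimately show "dist (f z) (f w) \<le> C * infdist (f z) (frontier V)"
      using C(2)[OF V, of "f \<circ> \<phi>" a] a \<phi> by simp
  qed
qed

section \<open>Borel--Cantelli for radial limits\<close>

lemma measurable_cis [measurable]: "cis \<in> borel_measurable borel"
  by (intro borel_measurable_continuous_onI continuous_intros)

lemma measure_circle_measure:
  "A \<in> sets borel \<Longrightarrow> measure circle_measure A = measure angle_measure (cis -` A)"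
  unfolding circle_measure_eq by (simp add: measure_distr)

lemma finite_measure_circle_measure: "finite_measure circle_measure"
  unfolding circle_measure_eq
  by (rule angle.finite_measure_distr) simp

lemma sets_circle_measure [simp, measurable_cong]: "sets circle_measure = sets borel"
  and space_circle_measure [simp]: "space circle_measure = UNIV"
  by (simp_all add: circle_measure_def)

interpretation circle: finite_measure circle_measure
  by (rule finite_measure_circle_measure)

text \<open>Quantifying over \<open>v\<close> avoids assuming that radial limits exist: a limit
  farther than \<open>e\<close> from \<open>G n 0\<close> forces the values near the end of the
  radius to be that far too. The measure of this event is summable in \<open>n\<close>.\<close>

lemma AE_radial_values_close:
  assumes V: "\<And>n. simply_connected_domain (V n)"
    and G: "\<And>n. G n holomorphic_on ball 0 1" "\<And>n. G n ` ball 0 1 \<subseteq> V n"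
    and sum: "summable (\<lambda>n. sqrt (infdist (G n 0) (frontier (V n))))" and e: "e > 0"
  shows "AE \<xi> in circle_measure. \<xi> \<in> sphere 0 1 \<longrightarrow>
    (\<forall>\<^sub>F n in sequentially. \<forall>v. ((\<lambda>r. G n (of_real r * \<xi>)) \<longlongrightarrow> v) (at_left 1) \<longrightarrow> dist (G n 0) v \<le> e)"
proof -
  define r where "r k = 1 - 1 / real (k + 2)" for k
  have r: "0 < r k" "r k < 1" for k
    by (auto simp: r_def field_simps)
  have "r \<longlonglongrightarrow> 1 - 0"
    unfolding r_def by (intro tendsto_intros LIMSEQ_ignore_initial_segment[OF lim_1_over_n])
  then have rlim: "filterlim r (at_left 1) sequentially"
    using r by (auto simp: filterlim_at less_imp_neq)
  define A where "A n k = {\<xi> \<in> sphere 0 1. e < dist (G n 0) (G n (of_real (r k) * \<xi>))}" for n k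
  \<comment> \<open>Deviation on all circles from index \<open>m\<close> on: increasing in
    \<open>m\<close> and contained in \<open>A n m\<close>, so the bound for a single circle
    survives in the union over \<open>m\<close>.\<close>
  define B where "B n m = (\<Inter>k\<in>{m..}. A n k)" for n m
  have A: "A n k \<in> sets borel" for n k
  proof -
    have "closed {\<xi> \<in> sphere 0 1. dist (G n 0) (G n (of_real (r k) * \<xi>)) \<le> e}"
      by (intro continuous_on_closed_Collect_le continuous_intros closed_sphere
          continuous_on_radial[OF holomorphic_on_imp_continuous_on[OF G(1)] r])
    then have "sphere 0 1 - {\<xi> \<in> sphere 0 1. dist (G n 0) (G n (of_real (r k) * \<xi>)) \<le> e} \<in> sets borel"
      by (intro sets.Diff borel_closed closed_sphere)
    also have "sphere 0 1 - {\<xi> \<in> sphere 0 1. dist (G n 0) (G n (of_real (r k) * \<xi>)) \<le> e} = A n k"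
      by (auto simp: A_def)
    finally show ?thesis .
  qed
  then have B: "B n m \<in> sets borel" for n m
    unfolding B_def by (intro sets.countable_INT') auto
  define c where "c n = 2 * sqrt 2 / ln 2 * sqrt (infdist (G n 0) (frontier (V n)) / e)" for n
  have bound: "measure circle_measure (B n m) \<le> c n" for n m
  proof -
    have "measure circle_measure (B n m) \<le> measure circle_measure (A n m)"
      using A B by (intro circle.finite_measure_mono) (auto simp: B_def)
    also have "\<dots> = measure angle_measure {t. e < dist (G n 0) (G n (of_real (r m) * cis t))}"
      using A by (simp add: measure_circle_measure A_def)
    also have "\<dots> \<le> c n"
      unfolding c_def by (rule beurling_estimate_sqrt) (use V G r e in auto)
    finally show ?thesis .
  qed
  have "incseq (B n)" for n
    by (auto simp: incseq_def B_def)
  then have lim: "(\<lambda>m. measure circle_measure (B n m)) \<longlonglongrightarrow> measure circle_measure (\<Union>m. B n m)" for n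
    using B by (intro circle.finite_Lim_measure_incseq) auto
  have le: "measure circle_measure (\<Union>m. B n m) \<le> c n" for n
    by (rule LIMSEQ_le_const2[OF lim]) (use bound in blast)
  have "summable c"
    unfolding c_def real_sqrt_divide using sum by (intro summable_mult summable_divide)
  then have "summable (\<lambda>n. measure circle_measure (\<Union>m. B n m))"
    by (rule summable_comparison_test') (use le in auto)
  then have "AE \<xi> in circle_measure. \<forall>\<^sub>F n in sequentially. \<xi> \<in> space circle_measure - (\<Union>m. B n m)"
    using B circle.emeasure_finite by (intro borel_cantelli_AE1) (auto simp: less_top[symmetric])
  then show ?thesis
  proof eventually_elim
    case (elim \<xi>)
    show ?case
    proof
      assume \<xi>: "\<xi> \<in> sphere 0 1"
      show "\<forall>\<^sub>F n in sequentially. \<forall>v. ((\<lambda>r. G n (of_real r * \<xi>)) \<longlongrightarrow> v) (at_left 1) \<longrightarrow> dist (G n 0) v \<le> e"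
        using elim
      proof eventually_elim
        case (elim n)
        show ?case
        proof (intro allI impI, rule ccontr)
          fix v assume v: "((\<lambda>r. G n (of_real r * \<xi>)) \<longlongrightarrow> v) (at_left 1)" and "\<not> dist (G n 0) v \<le> e"
          have "(\<lambda>k. dist (G n 0) (G n (of_real (r k) * \<xi>))) \<longlonglongrightarrow> dist (G n 0) v"
            by (intro tendsto_intros filterlim_compose[OF v rlim])
          then have "\<forall>\<^sub>F k in sequentially. e < dist (G n 0) (G n (of_real (r k) * \<xi>))"
            using \<open>\<not> dist (G n 0) v \<le> e\<close> by (intro order_tendstoD(1)) auto
          then show False
            using elim \<xi> by (auto simp: B_def A_def eventually_sequentially)
        qed
      qed
    qed
  qed
qed

lemma AE_radial_values_tendsto:
  assumes V: "\<And>n. simply_connected_domain (V n)"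
    and G: "\<And>n. G n holomorphic_on ball 0 1" "\<And>n. G n ` ball 0 1 \<subseteq> V n"
    and sum: "summable (\<lambda>n. sqrt (infdist (G n 0) (frontier (V n))))"
  shows "AE \<xi> in circle_measure. \<xi> \<in> sphere 0 1 \<longrightarrow>
    (\<forall>v. (\<forall>n. ((\<lambda>r. G n (of_real r * \<xi>)) \<longlongrightarrow> v n) (at_left 1)) \<longrightarrow> (\<lambda>n. dist (G n 0) (v n)) \<longlonglongrightarrow> 0)"
proof -
  \<comment> \<open>Countably many tolerances keep the exceptional set null.\<close>
  have "AE \<xi> in circle_measure. \<forall>j. \<xi> \<in> sphere 0 1 \<longrightarrow>
    (\<forall>\<^sub>F n in sequentially. \<forall>v. ((\<lambda>r. G n (of_real r * \<xi>)) \<longlongrightarrow> v) (at_left 1) \<longrightarrow> dist (G n 0) v \<le> inverse (real (Suc j)))"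
    unfolding AE_all_countable
    by (intro allI AE_radial_values_close[OF V G sum]) auto
  then show ?thesis
  proof eventually_elim
    case (elim \<xi>)
    show ?case
    proof (intro impI allI tendstoI)
      fix v and e :: real
      assume \<xi>: "\<xi> \<in> sphere 0 1" and v: "\<forall>n. ((\<lambda>r. G n (of_real r * \<xi>)) \<longlongrightarrow> v n) (at_left 1)" and "e > 0"
      obtain j where j: "inverse (real (Suc j)) < e"
        using reals_Archimedean[OF \<open>e > 0\<close>] by blast
      have "\<forall>\<^sub>F n in sequentially. \<forall>v. ((\<lambda>r. G n (of_real r * \<xi>)) \<longlongrightarrow> v) (at_left 1) \<longrightarrow> dist (G n 0) v \<le> inverse (real (Suc j))"
        using elim \<xi> by blast
      then show "\<forall>\<^sub>F n in sequentially. dist (dist (G n 0) (v n)) 0 < e"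
      proof eventually_elim
        case (elim n)
        then have "dist (G n 0) (v n) \<le> inverse (real (Suc j))"
          using v by blast
        then show ?case
          using j by simp
      qed
    qed
  qed
qed

subsection \<open>Harmonic measure and radial limits\<close>

lemma compact_inner_approximation:
  fixes M :: "'a :: {second_countable_topology, complete_space} measure"
  assumes "finite_measure M" "sets M = sets borel" "B \<in> sets borel" "e > 0"
  obtains K where "compact K" "K \<subseteq> B" "measure M (B - K) < e"
proof -
  interpret finite_measure M by fact
  have SUP: "emeasure M B = (SUP K \<in> {K. K \<subseteq> B \<and> compact K}. emeasure M K)"
    by (rule inner_regular) (use assms in auto)
  have ne: "{K. K \<subseteq> B \<and> compact K} \<noteq> {}"
    using compact_empty by blast
  obtain K where K: "K \<subseteq> B" "compact K" "emeasure M B < emeasure M K + ennreal e"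
    using SUP_approx_ennreal[OF assms(4) ne SUP] by auto
  have sets: "K \<in> sets M"
    using K assms by (simp add: compact_imp_closed)
  have "measure M B < measure M K + e"
    using K(3) assms(4) by (simp add: emeasure_eq_measure ennreal_plus[symmetric] ennreal_less_iff del: ennreal_plus)
  then have "measure M (B - K) < e"
    using finite_measure_Diff[of B K] sets K assms by auto
  then show ?thesis
    using that K by blast
qed

text \<open>The preimages \<open>P n\<close> of basic open sets and their complements in
  \<open>E\<close> are approximated from inside by compact sets \<open>K n\<close> and
  \<open>L n\<close>. On the intersection \<open>C\<close> of all \<open>K n \<union> L n\<close>,
  removing the closed set \<open>L n\<close> leaves only points of \<open>P n\<close>, so
  \<open>f\<close> is continuous there.\<close>

theorem lusin:
  fixes M :: "'a :: {second_countable_topology, complete_space} measure"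
    and f :: "'a \<Rightarrow> 'b :: second_countable_topology"
  assumes fin: "finite_measure M" and M: "sets M = sets borel" and E: "E \<in> sets borel"
    and f: "f \<in> measurable (restrict_space borel E) borel" and e: "e > 0"
  obtains K where "compact K" "K \<subseteq> E" "measure M (E - K) < e" "continuous_on K f"
proof -
  interpret finite_measure M by fact
  obtain B :: "'b set set" where B: "countable B" "topological_basis B"
    using ex_countable_basis by blast
  have ne: "B \<noteq> {}"
    using topological_basisE[OF B(2) open_UNIV, of undefined] by auto
  define b where "b = from_nat_into B"
  have b: "range b = B"
    unfolding b_def by (rule range_from_nat_into) fact+
  define P where "P n = f -` b n \<inter> E" for n
  have "open (b n)" for n
    using b B(2) topological_basis_open by blast
  then have P: "P n \<in> sets borel" for n
    using measurable_sets[OF f, of "b n"] E by (simp add: P_def space_restrict_space sets_restrict_space_iff)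
  \<comment> \<open>Two errors below \<open>e / 2 ^ (n + 3)\<close> for each \<open>n\<close> add up
    to at most \<open>e / 2\<close>.\<close>
  have "\<exists>K L. compact K \<and> compact L \<and> K \<subseteq> P n \<and> L \<subseteq> E - P n \<and> 
      measure M (P n - K) < e * (1 / 2) ^ (n + 3) \<and> measure M ((E - P n) - L) < e * (1 / 2) ^ (n + 3)" for n
  proof -
    have pos: "e * (1 / 2) ^ (n + 3) > 0" using e by simp
    obtain K where "compact K" "K \<subseteq> P n" "measure M (P n - K) < e * (1 / 2) ^ (n + 3)"
      using compact_inner_approximation[OF fin M P pos] .
    moreover have "E - P n \<in> sets borel" using E P by auto
    from compact_inner_approximation[OF fin M this pos]
    obtain L where "compact L" "L \<subseteq> E - P n" "measure M ((E - P n) - L) < e * (1 / 2) ^ (n + 3)" .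
    ultimately show ?thesis by blast
  qed
  then obtain K L where KL: "\<And>n. compact (K n)" "\<And>n. compact (L n)" "\<And>n. K n \<subseteq> P n" "\<And>n. L n \<subseteq> E - P n"
      "\<And>n. measure M (P n - K n) < e * (1 / 2) ^ (n + 3)" "\<And>n. measure M ((E - P n) - L n) < e * (1 / 2) ^ (n + 3)"
    by metis
  define C where "C = (\<Inter>n. K n \<union> L n)"
  have "compact C"
  proof -
    have "compact ((K 0 \<union> L 0) \<inter> C)"
      unfolding C_def using KL(1,2)
      by (intro compact_Int_closed closed_INT ballI compact_imp_closed compact_Un) auto
    also have "(K 0 \<union> L 0) \<inter> C = C"
      by (auto simp: C_def)
    finally show ?thesis .
  qed
  have CE: "C \<subseteq> E"
    using KL(3)[of 0] KL(4)[of 0] by (auto simp: C_def P_def)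
  have sets: "K n \<in> sets borel" "L n \<in> sets borel" for n
    using KL by (auto intro: borel_compact)
  define D where "D n = E - (K n \<union> L n)" for n
  have D: "D n \<in> sets M" for n
    using sets E by (auto simp: D_def M)
  have D_le: "measure M (D n) \<le> e / 4 * (1 / 2) ^ n" for n
  proof -
    have "measure M (D n) \<le> measure M ((P n - K n) \<union> ((E - P n) - L n))"
      using P sets E by (intro finite_measure_mono) (auto simp: D_def M)
    also have "\<dots> \<le> measure M (P n - K n) + measure M ((E - P n) - L n)"
      using P sets E by (intro measure_Un_le) (auto simp: M)
    also have "\<dots> \<le> e / 4 * (1 / 2) ^ n"
      using KL(5,6)[of n] by (simp add: power_add power3_eq_cube)
    finally show ?thesis .
  qed
  have geo: "(\<lambda>n. e / 4 * (1 / 2) ^ n) sums (e / 4 * (1 / (1 - 1 / 2)))"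
    by (intro sums_mult geometric_sums) auto
  have smD: "summable (\<lambda>n. measure M (D n))"
    by (rule summable_comparison_test'[OF sums_summable[OF geo]]) (use D_le in auto)
  have "E - C = (\<Union>n. D n)"
    by (auto simp: C_def D_def)
  then have "measure M (E - C) \<le> (\<Sum>n. measure M (D n))"
    using finite_measure_subadditive_countably[of D] D smD by auto
  also have "\<dots> \<le> (\<Sum>n. e / 4 * (1 / 2) ^ n)"
    by (intro suminf_le D_le smD sums_summable[OF geo])
  also have "\<dots> < e"
    using sums_unique[OF geo] e by simp
  finally have small: "measure M (E - C) < e" .
  have "continuous_on C f"
    unfolding continuous_on_topological
  proof (intro ballI allI impI)
    fix x O' assume x: "x \<in> C" and O': "open O'" "f x \<in> O'"
    obtain n where n: "f x \<in> b n" "b n \<subseteq> O'"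
      using topological_basisE[OF B(2) O'] b by (metis rangeE)
    have "x \<notin> L n"
      using x n(1) CE KL(4)[of n] by (auto simp: P_def)
    moreover have "f y \<in> O'" if "y \<in> C" "y \<notin> L n" for y
      using that KL(3)[of n] n(2) by (auto simp: C_def P_def)
    moreover have "open (- L n)"
      using KL(2) compact_imp_closed by blast
    ultimately show "\<exists>A. open A \<and> x \<in> A \<and> (\<forall>y\<in>C. y \<in> A \<longrightarrow> f y \<in> O')"
      by blast
  qed
  then show ?thesis
    using that \<open>compact C\<close> CE small by blast
qed

text \<open>The set \<open>A\<close> need not be Borel, and images of Borel sets under the radial limit map need not be either. Lusin's
  theorem provides a \<open>\<sigma>\<close>-compact subset of \<open>A\<close> that has full measure.\<close>

lemma AE_harmonic_measureI:
  assumes U: "simply_connected_domain U" "z \<in> U"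
    and AE: "AE \<xi> in circle_measure. \<xi> \<in> radial_limit_dom (riemann_map_at U z) \<longrightarrow>
        radial_limit (riemann_map_at U z) \<xi> \<in> A"
  shows "AE \<zeta> in harmonic_measure U z. \<zeta> \<in> A"
proof -
  define \<phi> where "\<phi> = riemann_map_at U z"
  have \<phi>: "riemann_map U \<phi>"
    unfolding \<phi>_def by (rule riemann_map_at[OF U])
  then have dom: "radial_limit_dom \<phi> \<in> sets borel"
    by (auto simp: riemann_map_def intro!: borel_radial_limit_dom holomorphic_on_imp_continuous_on)
  obtain N where N: "N \<in> null_sets circle_measure"
      "{\<xi>. \<not> (\<xi> \<in> radial_limit_dom \<phi> \<longrightarrow> radial_limit \<phi> \<xi> \<in> A)} \<subseteq> N"
    using AE unfolding eventually_ae_filter \<phi>_def by auto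
  define E where "E = radial_limit_dom \<phi> - N"
  have E: "E \<in> sets borel"
    using N dom by (auto simp: E_def null_sets_def)
  have meas: "radial_limit \<phi> \<in> measurable (restrict_space borel E) borel"
  proof -
    have "radial_limit \<phi> \<in> measurable (restrict_space circle_measure (radial_limit_dom \<phi>)) borel"
      using measurable_radial_limit[OF \<phi>] by (rule measurable_restrict_space2_iff[THEN iffD1, THEN conjunct1])
    also have "measurable (restrict_space circle_measure (radial_limit_dom \<phi>)) borel =
        measurable (restrict_space borel (radial_limit_dom \<phi>)) (borel :: complex measure)"
      by (intro measurable_cong_sets sets_restrict_space_cong) simp_all
    finally show ?thesis
      by (rule measurable_restrict_mono) (auto simp: E_def)
  qed
  have "\<exists>K. compact K \<and> K \<subseteq> E \<and> measure circle_measure (E - K) < inverse (real (Suc j)) \<and>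
      continuous_on K (radial_limit \<phi>)" for j
    by (rule lusin[OF finite_measure_circle_measure sets_circle_measure E meas, of "inverse (real (Suc j))"]) auto
  then obtain K where K: "\<And>j. compact (K j)" "\<And>j. K j \<subseteq> E"
      "\<And>j. measure circle_measure (E - K j) < inverse (real (Suc j))" "\<And>j. continuous_on (K j) (radial_limit \<phi>)"
    by metis
  \<comment> \<open>Images of compact sets under continuous maps are compact, so \<open>W\<close> is
    Borel even if the image of \<open>E\<close> is not.\<close>
  define W where "W = (\<Union>j. radial_limit \<phi> ` K j)"
  have W: "W \<in> sets borel"
    unfolding W_def using K(1,4) by (intro sets.countable_UN) (auto intro!: borel_compact compact_continuous_image)
  have WA: "W \<subseteq> A"
    using K(2) N(2) by (fastforce simp: W_def E_def)
  have null: "(\<Inter>j. E - K j) \<in> null_sets circle_measure"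
  proof -
    have sets: "E - K j \<in> sets borel" for j
      using E K(1) by (auto intro: borel_compact)
    then have sets': "(\<Inter>j. E - K j) \<in> sets borel"
      by (intro sets.countable_INT') auto
    have "measure circle_measure (\<Inter>j. E - K j) \<le> inverse (real (Suc j))" for j
      using circle.finite_measure_mono[of "\<Inter>j. E - K j" "E - K j"] sets K(3)[of j] by fastforce
    then have "measure circle_measure (\<Inter>j. E - K j) \<le> 0"
      by (intro LIMSEQ_le_const[OF LIMSEQ_inverse_real_of_nat]) auto
    then show ?thesis
      using sets' by (simp add: null_sets_def circle.emeasure_eq_measure measure_le_0_iff)
  qed
  have Un: "N \<union> (\<Inter>j. E - K j) \<in> null_sets circle_measure"
    using N(1) null by auto
  \<comment> \<open>A point whose radial limit avoids \<open>W\<close> lies in \<open>N\<close>, or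
    in \<open>E\<close> outside every \<open>K j\<close>.\<close>
  have "emeasure (harmonic_measure U z) (frontier U - W) =
      emeasure circle_measure {\<xi> \<in> radial_limit_dom \<phi>. radial_limit \<phi> \<xi> \<in> frontier U - W}"
    unfolding \<phi>_def using W by (intro emeasure_harmonic_measure[OF U]) auto
  also have "\<dots> \<le> emeasure circle_measure (N \<union> (\<Inter>j. E - K j))"
    using Un by (intro emeasure_mono) (auto simp: W_def E_def null_sets_def)
  also have "\<dots> = 0"
    using Un by auto
  finally have "emeasure (harmonic_measure U z) (frontier U - W) = 0"
    by simp
  moreover have "frontier U - W \<in> sets (harmonic_measure U z)" "space (harmonic_measure U z) = frontier U"
    using W by (auto simp: harmonic_measure_def Let_def sets_restrict_space space_restrict_space)
  ultimately show ?thesis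
    using WA by (intro AE_I[of _ _ "frontier U - W"]) auto
qed

section \<open>Radii and radial extensions\<close>

text \<open>A radius satisfies the Stolz condition with constant \<open>1\<close>, since
  \<open>|t * \<xi> - \<xi>| = 1 - |t * \<xi>|\<close>; its image is therefore a test arc for radial
  extensions.\<close>

lemma radial_arc:
  assumes \<phi>: "riemann_map U \<phi>" and \<xi>: "\<xi> \<in> radial_limit_dom \<phi>"
  shows "arc_in U (\<lambda>t. \<phi> (of_real t * \<xi>))"
    and "approaches_radially U (\<lambda>t. \<phi> (of_real t * \<xi>)) (radial_limit \<phi> \<xi>)"
proof -
  have cont: "continuous_on (ball 0 1) \<phi>" and inj: "inj_on \<phi> (ball 0 1)" and U: "\<phi> ` ball 0 1 = U"
    using \<phi> by (auto simp: riemann_map_def bij_betw_def holomorphic_on_imp_continuous_on)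
  have norm: "cmod \<xi> = 1"
    using \<xi> by (simp add: radial_limit_dom_def)
  have mem: "of_real t * \<xi> \<in> ball 0 1" if "t \<in> {0..<1}" for t
    using that norm by (simp add: norm_mult)
  have "continuous_on {0..<1} (\<lambda>t. \<phi> (of_real t * \<xi>))"
    using mem by (intro continuous_on_compose2[OF cont] continuous_intros) auto
  moreover have "inj_on (\<lambda>t. \<phi> (of_real t * \<xi>)) {0..<1}"
  proof (rule inj_onI)
    fix s t :: real
    assume st: "s \<in> {0..<1}" "t \<in> {0..<1}" and "\<phi> (of_real s * \<xi>) = \<phi> (of_real t * \<xi>)"
    then have "of_real s * \<xi> = of_real t * \<xi>"
      using inj_onD[OF inj] mem by blast
    then show "s = t"
      using norm by auto
  qed
  ultimately show "arc_in U (\<lambda>t. \<phi> (of_real t * \<xi>))"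
    using mem U by (auto simp: arc_in_def)
  have "((\<lambda>t. complex_of_real t * \<xi>) \<longlongrightarrow> of_real 1 * \<xi>) (at_left 1)"
    by (intro tendsto_intros)
  moreover have "\<forall>\<^sub>F t in at_left 1. cmod (of_real t * \<xi> - \<xi>) \<le> 1 * (1 - cmod (of_real t * \<xi>))"
  proof (rule eventually_at_leftI)
    fix t :: real assume t: "t \<in> {0<..<1}"
    have "of_real t * \<xi> - \<xi> = of_real (t - 1) * \<xi>"
      by (simp add: algebra_simps)
    then have "cmod (of_real t * \<xi> - \<xi>) = \<bar>t - 1\<bar>"
      using norm by (simp only: norm_mult norm_of_real mult_1_right)
    then show "cmod (of_real t * \<xi> - \<xi>) \<le> 1 * (1 - cmod (of_real t * \<xi>))"
      using t norm by (simp add: norm_mult)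
  qed simp
  ultimately have "approaches_nontangentially (\<lambda>t. of_real t * \<xi>) \<xi>"
    unfolding approaches_nontangentially_def
    using mem norm by (auto intro!: continuous_intros exI[of _ 1])
  then show "approaches_radially U (\<lambda>t. \<phi> (of_real t * \<xi>)) (radial_limit \<phi> \<xi>)"
    unfolding approaches_radially_def using \<phi> tendsto_radial_limit[OF \<xi>] by blast
qed

lemma has_radial_extension_imp_tendsto:
  assumes "riemann_map U \<phi>" "\<xi> \<in> radial_limit_dom \<phi>"
    and "has_radial_extension U f (radial_limit \<phi> \<xi>) v"
  shows "((\<lambda>r. f (\<phi> (of_real r * \<xi>))) \<longlongrightarrow> v) (at_left 1)"
  using assms radial_arc[OF assms(1,2)] by (auto simp: has_radial_extension_def)

text \<open>Any admissible value is the limit of \<open>f\<close> along the image of the radius to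
  \<open>\<xi>\<close>, so the definite description is well defined.\<close>

lemma tendsto_radial_extension:
  assumes \<phi>: "riemann_map U \<phi>" and \<xi>: "\<xi> \<in> radial_limit_dom \<phi>"
    and "radial_limit \<phi> \<xi> \<in> radial_extension_dom U f"
  shows "((\<lambda>r. f (\<phi> (of_real r * \<xi>))) \<longlongrightarrow> radial_extension U f (radial_limit \<phi> \<xi>)) (at_left 1)"
proof -
  obtain v where v: "has_radial_extension U f (radial_limit \<phi> \<xi>) v"
    using assms(3) by (auto simp: radial_extension_dom_def)
  have "radial_extension U f (radial_limit \<phi> \<xi>) = v"
    unfolding radial_extension_def
  proof (rule the_equality)
    show "has_radial_extension U f (radial_limit \<phi> \<xi>) v" by (rule v)
    fix w assume "has_radial_extension U f (radial_limit \<phi> \<xi>) w"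
    then show "w = v"
      using v has_radial_extension_imp_tendsto[OF \<phi> \<xi>] tendsto_unique[OF trivial_limit_at_left_real] by blast
  qed
  then show ?thesis
    using has_radial_extension_imp_tendsto[OF \<phi> \<xi> v] by simp
qed

section \<open>From the circle to the Denjoy--Wolff set\<close>

theorem theoremC:
  fixes U :: "complex set" and V :: "nat \<Rightarrow> complex set"
    and F :: "nat \<Rightarrow> complex \<Rightarrow> complex" and z0 :: complex
  assumes "simply_connected_domain U"
    and "\<And>n. simply_connected_domain (V n)"
    and "\<And>n. F n holomorphic_on U"
    and "\<And>n. F n ` U \<subseteq> V n"
    and "\<And>n. has_full_radial_extension U (F n)"
    and "z0 \<in> U"
    and "summable (\<lambda>n. infdist (F n z0) (frontier (V n)) powr (1 / 2))"
  shows "full_harmonic_measure U (Denjoy_Wolff_set U V F)"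
  unfolding full_harmonic_measure_def
proof
  \<comment> \<open>Full harmonic measure is tested at every base point \<open>z\<close>, while
    summability is given at \<open>z0\<close> and has to be carried over.\<close>
  fix z assume z: "z \<in> U"
  define d where "d n w = infdist (F n w) (frontier (V n))" for n w
  have d0: "0 \<le> d n w" for n w
    by (simp add: d_def infdist_nonneg)
  have sum: "summable (\<lambda>n. sqrt (d n z0))"
    using assms(7) by (simp add: powr_half_sqrt d_def infdist_nonneg)
  have "(\<lambda>n. (sqrt (d n z0))\<^sup>2) \<longlonglongrightarrow> 0\<^sup>2"
    by (intro tendsto_power summable_LIMSEQ_zero[OF sum])
  then have lim0: "(\<lambda>n. d n z0) \<longlonglongrightarrow> 0"
    by (simp add: d0)
  \<comment> \<open>The constant does not depend on \<open>n\<close>, so smallness and summability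
    pass from \<open>z0\<close> to every \<open>w\<close>.\<close>
  have "\<exists>C>0. \<forall>n. dist (F n z0) (F n w) \<le> C * d n z0" if "w \<in> U" for w
    using dist_image_le_infdist_frontier[OF assms(1,6) that] assms(2-4) unfolding d_def by metis
  then obtain C where C: "\<And>w. w \<in> U \<Longrightarrow> C w > 0" "\<And>n w. w \<in> U \<Longrightarrow> dist (F n z0) (F n w) \<le> C w * d n z0"
    by metis
  have limF: "(\<lambda>n. dist (F n z0) (F n w)) \<longlonglongrightarrow> 0" if "w \<in> U" for w
    by (rule tendsto_sandwich[OF _ _ tendsto_const, where h = "\<lambda>n. C w * d n z0"])
       (use C(2)[OF that] tendsto_mult_right_zero[OF lim0] in auto)
  have d_le: "d n w \<le> (1 + C w) * d n z0" if "w \<in> U" for n w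
    using infdist_triangle[of "F n w" "frontier (V n)" "F n z0"] C(2)[OF that, of n]
    by (simp add: d_def dist_commute algebra_simps)
  have limd: "(\<lambda>n. d n w) \<longlonglongrightarrow> 0" if "w \<in> U" for w
    by (rule tendsto_sandwich[OF _ _ tendsto_const, where h = "\<lambda>n. (1 + C w) * d n z0"])
       (use d_le[OF that] d0 tendsto_mult_right_zero[OF lim0] in auto)
  have sumz: "summable (\<lambda>n. sqrt (d n z))"
  proof (rule summable_comparison_test')
    show "summable (\<lambda>n. sqrt (1 + C z) * sqrt (d n z0))"
      by (intro summable_mult sum)
    show "norm (sqrt (d n z)) \<le> sqrt (1 + C z) * sqrt (d n z0)" for n
      using d_le[OF z, of n] d0[of n z] by (simp add: real_sqrt_mult[symmetric])
  qed
  define \<phi> where "\<phi> = riemann_map_at U z"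
  have \<phi>: "riemann_map U \<phi>" "\<phi> 0 = z"
    unfolding \<phi>_def by (rule riemann_map_at[OF assms(1) z])+
  then have hol: "\<phi> holomorphic_on ball 0 1" and img: "\<phi> ` ball 0 1 = U"
    by (auto simp: riemann_map_def bij_betw_def)
  have dom: "radial_limit_dom \<phi> \<in> sets borel"
    by (intro borel_radial_limit_dom holomorphic_on_imp_continuous_on hol)
  have "\<forall>n. \<exists>A. full_harmonic_measure U A \<and> A \<subseteq> radial_extension_dom U (F n)"
    using assms(5) unfolding has_full_radial_extension_def by blast
  then obtain A where A: "\<And>n. full_harmonic_measure U (A n)" "\<And>n. A n \<subseteq> radial_extension_dom U (F n)"
    by metis
  \<comment> \<open>An \<open>AE\<close> statement for an image measure pulls back to the source
    even if \<open>A n\<close> is not Borel; only the way back relies on Lusin's theorem.\<close>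
  have "AE \<xi> in circle_measure. \<xi> \<in> radial_limit_dom \<phi> \<longrightarrow> radial_limit \<phi> \<xi> \<in> A n" for n
  proof -
    have "AE \<zeta> in distr (restrict_space circle_measure (radial_limit_dom \<phi>))
        (restrict_space borel (frontier U)) (radial_limit \<phi>). \<zeta> \<in> A n"
      using A(1)[of n] z 
      unfolding full_harmonic_measure_def harmonic_measure_def \<phi>_def Let_def by blast
    from AE_distrD[OF measurable_radial_limit[OF \<phi>(1)] this]
    show ?thesis
      using dom by (simp add: AE_restrict_space_iff)
  qed
  then have "AE \<xi> in circle_measure. \<forall>n. \<xi> \<in> radial_limit_dom \<phi> \<longrightarrow> radial_limit \<phi> \<xi> \<in> A n"
    unfolding AE_all_countable by blast
  moreover have "AE \<xi> in circle_measure. \<xi> \<in> sphere 0 1 \<longrightarrow>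
    (\<forall>v. (\<forall>n. ((\<lambda>r. F n (\<phi> (of_real r * \<xi>))) \<longlongrightarrow> v n) (at_left 1)) \<longrightarrow> (\<lambda>n. dist (F n z) (v n)) \<longlonglongrightarrow> 0)"
  proof -
    have "(F n \<circ> \<phi>) holomorphic_on ball 0 1" for n
      using hol img assms(3) by (intro holomorphic_on_compose) auto
    moreover have "(F n \<circ> \<phi>) ` ball 0 1 \<subseteq> V n" for n
      using img assms(4) by (auto simp: image_comp[symmetric])
    ultimately show ?thesis
      using AE_radial_values_tendsto[of V "\<lambda>n. F n \<circ> \<phi>"] assms(2) sumz \<phi>(2) by (simp add: d_def)
  qed
  ultimately have "AE \<xi> in circle_measure. \<xi> \<in> radial_limit_dom \<phi> \<longrightarrow> radial_limit \<phi> \<xi> \<in> Denjoy_Wolff_set U V F"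
  proof eventually_elim
    case (elim \<xi>)
    show ?case
    proof
      assume \<xi>: "\<xi> \<in> radial_limit_dom \<phi>"
      let ?\<zeta> = "radial_limit \<phi> \<xi>"
      have ext: "?\<zeta> \<in> radial_extension_dom U (F n)" for n
        using elim(1) \<xi> A(2) by blast
      have "\<xi> \<in> sphere 0 1"
        using \<xi> by (simp add: radial_limit_dom_def)
      then have lim: "(\<lambda>n. dist (F n z) (radial_extension U (F n) ?\<zeta>)) \<longlonglongrightarrow> 0"
        using elim(2)[rule_format, where v = "\<lambda>n. radial_extension U (F n) ?\<zeta>"]
          tendsto_radial_extension[OF \<phi>(1) \<xi> ext] by simp
      \<comment> \<open>The limit is known relative to \<open>F n z\<close>; the triangle inequality
        through \<open>F n z0\<close> passes from \<open>z\<close> to any \<open>w\<close>.\<close>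
      have "(\<lambda>n. cmod (radial_extension U (F n) ?\<zeta> - F n w)) \<longlonglongrightarrow> 0" if w: "w \<in> U" for w
      proof (rule tendsto_sandwich[OF _ _ tendsto_const])
        show "(\<lambda>n. dist (F n z) (radial_extension U (F n) ?\<zeta>) + (dist (F n z0) (F n z) + dist (F n z0) (F n w))) \<longlonglongrightarrow> 0"
          using tendsto_add[OF lim tendsto_add[OF limF[OF z] limF[OF w]]] by simp
        show "\<forall>\<^sub>F n in sequentially. cmod (radial_extension U (F n) ?\<zeta> - F n w) \<le>
            dist (F n z) (radial_extension U (F n) ?\<zeta>) + (dist (F n z0) (F n z) + dist (F n z0) (F n w))"
        proof (intro always_eventually allI)
          fix n
          show "cmod (radial_extension U (F n) ?\<zeta> - F n w) \<le>
            dist (F n z) (radial_extension U (F n) ?\<zeta>) + (dist (F n z0) (F n z) + dist (F n z0) (F n w))"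
            using dist_triangle[of "radial_extension U (F n) ?\<zeta>" "F n w" "F n z"] dist_triangle3[of "F n z" "F n w" "F n z0"]
            by (simp add: dist_norm[symmetric] dist_commute)
        qed
      qed auto
      then show "?\<zeta> \<in> Denjoy_Wolff_set U V F"
        using radial_limit_in_frontier[OF \<phi>(1) \<xi>] ext limd by (simp add: Denjoy_Wolff_set_def d_def)
    qed
  qed
  then show "AE \<zeta> in harmonic_measure U z. \<zeta> \<in> Denjoy_Wolff_set U V F"
    unfolding \<phi>_def by (rule AE_harmonic_measureI[OF assms(1) z])
qed

end
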